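(* (Inversion formula, model-theoretic version.) Let $\mathcal{M}$ be a model of a theory in a first-order language $\mathcal{L}$ with at least two constant symbols $c_1,c_2$ satisfying $c_1\neq c_2$. Let $X,Y$ be definable sets, and let $S\subset X\times Y$ and $S'\subset Y\times X$ be definable subsets. Let $S\otimes_Y S'=\{((x,y),(y',x'))\in S\times S': y=y'\}$ and let $r:S\otimes_Y S'\to X\times X$, $((x,y),(y,x'))\mapsto(x,x')$, be the projection. Let $\Delta_X\subset X\times X$ be the diagonal, $X_1=(X\times X)\setminus\Delta_X$, $B_1=(S\otimes_Y S')\setminus r^{-1}(\Delta_X)$, $B_2=(S\otimes_Y S')\cap r^{-1}(\Delta_X)$, and let $B_1\to X_1$ and $B_2\to\Delta_X$ be the restrictions of $r$. Suppose that: ( * ) there exists $Z_1$ in $\mathrm{Def}$ such that $[B_1\to X_1]=[Z_1]$ in $SK_0(\mathrm{Def}_{X_1})$; ( ** ) there exists $Z_2$ in $\mathrm{Def}$ such that $[B_2\to\Delta_X]=[Z_1]+[Z_2]$ in $SK_0(\mathrm{Def}_{\Delta_X})$. If $Z\to X$ is in $\mathrm{Def}_X$, then $$\mathcal{R}_{S'}\circ\mathcal{R}_S([Z\to X])=[Z_2][Z\to X]+[Z_1][Z]\quad\text{in } SK_0(\mathrm{Def}_X),$$ and this is independent of the choice of $Z_2$ (i.e., if $Z_2'$ also satisfies ( ** ) with the same $Z_1$, then $[Z_2][Z\to X]+[Z_1][Z]=[Z_2'][Z\to X]+[Z_1][Z]$). Here classes $[W]\in SK_0(\mathrm{Def})$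 are viewed in $SK_0(\mathrm{Def}_U)$, for $U$ the relevant base ($X_1$, $\Delta_X$ or $X$), via $[W]\mapsto[W\times U\to U]$ with $W\times U\to U$ the projection.
   Context: Definable means definable in $\mathcal{M}$ by $\mathcal{L}$-formulas (with any one fixed convention on parameters). For a definable set $Z$, $\mathrm{Def}_Z$ is the category whose objects are definable sets $X$ with a definable map $X\to Z$ and whose morphisms are definable maps over $Z$; $\mathrm{Def}:=\mathrm{Def}_{\{c_1\}}$, and $[W]$ denotes the class $[W\to\{c_1\}]$. A semigroup is a commutative monoid with unit. The Grothendieck semigroup $SK_0(\mathrm{Def}_Z)$ is the quotient of the free abelian semigroup on symbols $[Y\to Z]$, with $Y\to Z$ in $\mathrm{Def}_Z$, by the relations: $[\emptyset\to Z]=0$; $[Y\to Z]=[Y'\to Z]$ if $Y\to Z$ and $Y'\to Z$ are isomorphic in $\mathrm{Def}_Z$; and $[(Y\cup Y')\to Z]+[(Y\cap Y')\to Z]=[Y\to Z]+[Y'\to Z]$ for $Y,Y'$ definable subsets of some $X\to Z$ in $\mathrm{Def}_Z$. It is a semi-ring with multiplication induced by fiber product over $Z$. For a definable map $f:X\to Y$, $f_!:SK_0(\mathrm{Def}_X)\to SK_0(\mathrm{Def}_Y)$ is given by $f_!([Z\to X])=[Z\to Y]$ (composition with $f$), and $f^*:SK_0(\mathrm{Def}_Y)\to SK_0(\mathrm{Def}_X)$ by $f^*([Z\to Y])=[Z\otimes_Y X\to X]$ (set-theoretic fiber product with its projection to $X$). Radon transform: with $q_X:S\to X$, $q_Y:S\to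 Y$ the restrictions to $S$ of the projections, $\mathcal{R}_S=q_{Y!}\circ q_X^*:SK_0(\mathrm{Def}_X)\to SK_0(\mathrm{Def}_Y)$. Likewise, with $q'_Y:S'\to Y$, $q'_X:S'\to X$ the restricted projections, $\mathcal{R}_{S'}=q'_{X!}\circ q_Y'^{*}:SK_0(\mathrm{Def}_Y)\to SK_0(\mathrm{Def}_X)$. *)

theory Defs
  imports "HOL-Library.Multiset" "HOL-Library.FuncSet" "HOL-Algebra.Ring"
begin

section \<open>First-order languages and structures\<close>

record ('f, 'r) language =
  funs :: "'f set"
  rels :: "'r set"
  farity :: "'f \<Rightarrow> nat"
  rarity :: "'r \<Rightarrow> nat"

datatype 'f fo_term = Var nat | App 'f "'f fo_term list"

datatype ('f, 'r) fo_formula =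
    FEq "'f fo_term" "'f fo_term"
  | FRel 'r "'f fo_term list"
  | FNeg "('f, 'r) fo_formula"
  | FConj "('f, 'r) fo_formula" "('f, 'r) fo_formula"
  | FEx nat "('f, 'r) fo_formula"

fun wf_term :: "('f, 'r) language \<Rightarrow> 'f fo_term \<Rightarrow> bool" where
  "wf_term L (Var i) = True"
| "wf_term L (App f ts) = (f \<in> funs L \<and> length ts = farity L f \<and> (\<forall>t\<in>set ts. wf_term L t))"

fun wf_formula :: "('f, 'r) language \<Rightarrow> ('f, 'r) fo_formula \<Rightarrow> bool" where
  "wf_formula L (FEq s t) = (wf_term L s \<and> wf_term L t)"
| "wf_formula L (FRel R ts) = (R \<in> rels L \<and> length ts = rarity L R \<and> (\<forall>t\<in>set ts. wf_term L t))"
| "wf_formula L (FNeg \<phi>) = wf_formula L \<phi>"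
| "wf_formula L (FConj \<phi> \<psi>) = (wf_formula L \<phi> \<and> wf_formula L \<psi>)"
| "wf_formula L (FEx i \<phi>) = wf_formula L \<phi>"

fun term_vars :: "'f fo_term \<Rightarrow> nat set" where
  "term_vars (Var i) = {i}"
| "term_vars (App f ts) = (\<Union>t\<in>set ts. term_vars t)"

fun free_vars :: "('f, 'r) fo_formula \<Rightarrow> nat set" where
  "free_vars (FEq s t) = term_vars s \<union> term_vars t"
| "free_vars (FRel R ts) = (\<Union>t\<in>set ts. term_vars t)"
| "free_vars (FNeg \<phi>) = free_vars \<phi>"
| "free_vars (FConj \<phi> \<psi>) = free_vars \<phi> \<union> free_vars \<psi>"
| "free_vars (FEx i \<phi>) = free_vars \<phi> - {i}"

text \<open>The universe of a structure is the whole type \<open>'m\<close>. Only the values of the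
  interpretations at symbols of the language and at argument lists of the right length matter.\<close>

record ('f, 'r, 'm) fo_structure =
  finterp :: "'f \<Rightarrow> 'm list \<Rightarrow> 'm"
  rinterp :: "'r \<Rightarrow> 'm list \<Rightarrow> bool"

fun term_val :: "('f, 'r, 'm) fo_structure \<Rightarrow> (nat \<Rightarrow> 'm) \<Rightarrow> 'f fo_term \<Rightarrow> 'm" where
  "term_val M e (Var i) = e i"
| "term_val M e (App f ts) = finterp M f (map (term_val M e) ts)"

fun sat :: "('f, 'r, 'm) fo_structure \<Rightarrow> (nat \<Rightarrow> 'm) \<Rightarrow> ('f, 'r) fo_formula \<Rightarrow> bool" where
  "sat M e (FEq s t) = (term_val M e s = term_val M e t)"
| "sat M e (FRel R ts) = rinterp M R (map (term_val M e) ts)"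
| "sat M e (FNeg \<phi>) = (\<not> sat M e \<phi>)"
| "sat M e (FConj \<phi> \<psi>) = (sat M e \<phi> \<and> sat M e \<psi>)"
| "sat M e (FEx i \<phi>) = (\<exists>a. sat M (e(i := a)) \<phi>)"

definition is_theory :: "('f, 'r) language \<Rightarrow> ('f, 'r) fo_formula set \<Rightarrow> bool" where
  "is_theory L T \<longleftrightarrow> (\<forall>\<phi>\<in>T. wf_formula L \<phi> \<and> free_vars \<phi> = {})"

definition is_model :: "('f, 'r, 'm) fo_structure \<Rightarrow> ('f, 'r) fo_formula set \<Rightarrow> bool" where
  "is_model M T \<longleftrightarrow> (\<forall>\<phi>\<in>T. \<forall>e. sat M e \<phi>)"

definition is_constant :: "('f, 'r) language \<Rightarrow> 'f \<Rightarrow> bool" where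
  "is_constant L c \<longleftrightarrow> c \<in> funs L \<and> farity L c = 0"

abbreviation const_val :: "('f, 'r, 'm) fo_structure \<Rightarrow> 'f \<Rightarrow> 'm" where
  "const_val M c \<equiv> finterp M c []"


section \<open>Definable sets and maps\<close>

text \<open>\<open>definable L M A n X\<close>: \<open>X\<close> is a subset of \<open>M\<^sup>n\<close> (lists of length \<open>n\<close>) definable by an
  \<open>L\<close>-formula with parameters from \<open>A\<close>. The variables \<open>0, \<dots>, n - 1\<close> stand for the coordinates
  and the following ones for the parameters. \<open>A = {}\<close> and \<open>A = UNIV\<close> are the two usual conventions.\<close>

definition definable ::
    "('f, 'r) language \<Rightarrow> ('f, 'r, 'm) fo_structure \<Rightarrow> 'm set \<Rightarrow> nat \<Rightarrow> 'm list set \<Rightarrow> bool" where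
  "definable L M A n X \<longleftrightarrow>
     (\<exists>\<phi> ps. wf_formula L \<phi> \<and> set ps \<subseteq> A \<and> free_vars \<phi> \<subseteq> {..<n + length ps} \<and>
        X = {xs. length xs = n \<and> sat M (\<lambda>i. (xs @ ps) ! i) \<phi>})"

text \<open>From here on \<open>D\<close> stands for \<open>definable L M A\<close>. A point of a product \<open>M\<^sup>m \<times> M\<^sup>n\<close> is the
  concatenation of its two components.\<close>

type_synonym 'm defpred = "nat \<Rightarrow> 'm list set \<Rightarrow> bool"

definition cprod :: "'m list set \<Rightarrow> 'm list set \<Rightarrow> 'm list set" where
  "cprod X Y = {x @ y | x y. x \<in> X \<and> y \<in> Y}"

definition fiber_prod ::
    "'m list set \<Rightarrow> ('m list \<Rightarrow> 'm list) \<Rightarrow> 'm list set \<Rightarrow> ('m list \<Rightarrow> 'm list) \<Rightarrow> 'm list set" where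
  "fiber_prod V f W g = {v @ w | v w. v \<in> V \<and> w \<in> W \<and> f v = g w}"

definition definable_map ::
    "'m defpred \<Rightarrow> nat \<Rightarrow> 'm list set \<Rightarrow> nat \<Rightarrow> 'm list set \<Rightarrow> ('m list \<Rightarrow> 'm list) \<Rightarrow> bool" where
  "definable_map D n X m Y f \<longleftrightarrow>
     D n X \<and> D m Y \<and> f \<in> X \<rightarrow> Y \<and> D (n + m) {x @ f x | x. x \<in> X}"


section \<open>The category of definable sets over a base\<close>

text \<open>The triple \<open>(n, X, f)\<close> is the map \<open>f\<close> from \<open>X \<subseteq> M\<^sup>n\<close> to the base. The values of \<open>f\<close> outside
  \<open>X\<close> are irrelevant: triples differing only there are isomorphic, hence have the same class
  in the Grothendieck semigroup.\<close>

type_synonym 'm dobj = "nat \<times> 'm list set \<times> ('m list \<Rightarrow> 'm list)"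

definition Def :: "'m defpred \<Rightarrow> nat \<Rightarrow> 'm list set \<Rightarrow> 'm dobj set" where
  "Def D m Z = {(n, X, f). definable_map D n X m Z f}"

fun morphism :: "'m defpred \<Rightarrow> 'm dobj \<Rightarrow> 'm dobj \<Rightarrow> ('m list \<Rightarrow> 'm list) \<Rightarrow> bool" where
  "morphism D (n, X, f) (n', X', f') h \<longleftrightarrow>
     definable_map D n X n' X' h \<and> (\<forall>x\<in>X. f' (h x) = f x)"

fun isomorphic :: "'m defpred \<Rightarrow> 'm dobj \<Rightarrow> 'm dobj \<Rightarrow> bool" where
  "isomorphic D (n, X, f) (n', X', f') \<longleftrightarrow>
     (\<exists>h k. morphism D (n, X, f) (n', X', f') h \<and> morphism D (n', X', f') (n, X, f) k \<and>
        (\<forall>x\<in>X. k (h x) = x) \<and> (\<forall>x'\<in>X'. h (k x') = x'))"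


section \<open>The Grothendieck semigroup\<close>

text \<open>The free abelian semigroup on the objects over \<open>Z \<subseteq> M\<^sup>m\<close> consists of the finite multisets
  of objects. \<open>SK_rel D m Z\<close> is the smallest congruence on it containing the defining relations.\<close>

definition free_SK :: "'m defpred \<Rightarrow> nat \<Rightarrow> 'm list set \<Rightarrow> 'm dobj multiset set" where
  "free_SK D m Z = {u. set_mset u \<subseteq> Def D m Z}"

inductive_set SK_rel ::
    "'m defpred \<Rightarrow> nat \<Rightarrow> 'm list set \<Rightarrow> ('m dobj multiset \<times> 'm dobj multiset) set"
  for D m Z where
  empty: "(n, {}, f) \<in> Def D m Z \<Longrightarrow> ({#(n, {}, f)#}, {#}) \<in> SK_rel D m Z"
| iso: "\<lbrakk>W \<in> Def D m Z; W' \<in> Def D m Z; isomorphic D W W'\<rbrakk>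
    \<Longrightarrow> ({#W#}, {#W'#}) \<in> SK_rel D m Z"
| scissor: "\<lbrakk>(n, X, f) \<in> Def D m Z; D n Y; Y \<subseteq> X; D n Y'; Y' \<subseteq> X\<rbrakk>
    \<Longrightarrow> ({#(n, Y \<union> Y', f), (n, Y \<inter> Y', f)#}, {#(n, Y, f), (n, Y', f)#}) \<in> SK_rel D m Z"
| refl: "u \<in> free_SK D m Z \<Longrightarrow> (u, u) \<in> SK_rel D m Z"
| sym: "(u, v) \<in> SK_rel D m Z \<Longrightarrow> (v, u) \<in> SK_rel D m Z"
| trans: "\<lbrakk>(u, v) \<in> SK_rel D m Z; (v, w) \<in> SK_rel D m Z\<rbrakk> \<Longrightarrow> (u, w) \<in> SK_rel D m Z"
| add: "\<lbrakk>(u, v) \<in> SK_rel D m Z; w \<in> free_SK D m Z\<rbrakk> \<Longrightarrow> (u + w, v + w) \<in> SK_rel D m Z"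

text \<open>Fiber product over the base.\<close>

fun fiber_obj :: "'m dobj \<Rightarrow> 'm dobj \<Rightarrow> 'm dobj" where
  "fiber_obj (n, W, f) (n', W', f') = (n + n', fiber_prod W f W' f', \<lambda>v. f (take n v))"

definition mult_free :: "'m dobj multiset \<Rightarrow> 'm dobj multiset \<Rightarrow> 'm dobj multiset" where
  "mult_free u v = (\<Sum>a\<in>#u. image_mset (fiber_obj a) v)"

text \<open>Operations on classes are defined through representatives, as unions of classes.\<close>

definition SK0 :: "'m defpred \<Rightarrow> nat \<Rightarrow> 'm list set \<Rightarrow> 'm dobj multiset set ring" where
  "SK0 D m Z =
     \<lparr>carrier = free_SK D m Z // SK_rel D m Z,
      mult = (\<lambda>C C'. \<Union>u\<in>C. \<Union>v\<in>C'. SK_rel D m Z `` {mult_free u v}),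
      one = SK_rel D m Z `` {{#(m, Z, \<lambda>z. z)#}},
      zero = SK_rel D m Z `` {{#}},
      add = (\<lambda>C C'. \<Union>u\<in>C. \<Union>v\<in>C'. SK_rel D m Z `` {u + v})\<rparr>"

definition SK_class :: "'m defpred \<Rightarrow> nat \<Rightarrow> 'm list set \<Rightarrow> 'm dobj \<Rightarrow> 'm dobj multiset set" where
  "SK_class D m Z W = SK_rel D m Z `` {{#W#}}"


section \<open>Direct image, inverse image, Radon transform\<close>

text \<open>The additive map to \<open>SK0 D m Z\<close> induced by a map \<open>F\<close> on objects.\<close>

definition SK_induced ::
    "'m defpred \<Rightarrow> nat \<Rightarrow> 'm list set \<Rightarrow> ('m dobj \<Rightarrow> 'm dobj)
      \<Rightarrow> 'm dobj multiset set \<Rightarrow> 'm dobj multiset set" where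
  "SK_induced D m Z F C = (\<Union>u\<in>C. SK_rel D m Z `` {image_mset F u})"

text \<open>\<open>push D m Y f\<close> is \<open>f\<^sub>!\<close> for a map \<open>f\<close> to \<open>Y \<subseteq> M\<^sup>m\<close>.\<close>

definition push_obj :: "('m list \<Rightarrow> 'm list) \<Rightarrow> 'm dobj \<Rightarrow> 'm dobj" where
  "push_obj f = (\<lambda>(n, W, g). (n, W, f \<circ> g))"

definition push ::
    "'m defpred \<Rightarrow> nat \<Rightarrow> 'm list set \<Rightarrow> ('m list \<Rightarrow> 'm list)
      \<Rightarrow> 'm dobj multiset set \<Rightarrow> 'm dobj multiset set" where
  "push D m Y f = SK_induced D m Y (push_obj f)"

text \<open>\<open>pull D n X f\<close> is \<open>f\<^sup>*\<close> for a map \<open>f\<close> from \<open>X \<subseteq> M\<^sup>n\<close>.\<close>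

definition pull_obj :: "'m list set \<Rightarrow> ('m list \<Rightarrow> 'm list) \<Rightarrow> nat \<Rightarrow> 'm dobj \<Rightarrow> 'm dobj" where
  "pull_obj X f n = (\<lambda>(k, W, g). (k + n, fiber_prod W g X f, drop k))"

definition pull ::
    "'m defpred \<Rightarrow> nat \<Rightarrow> 'm list set \<Rightarrow> ('m list \<Rightarrow> 'm list)
      \<Rightarrow> 'm dobj multiset set \<Rightarrow> 'm dobj multiset set" where
  "pull D n X f = SK_induced D n X (pull_obj X f n)"

text \<open>For \<open>S \<subseteq> X \<times> Y\<close> with \<open>X \<subseteq> M\<^sup>a\<close> and \<open>Y \<subseteq> M\<^sup>b\<close> the projections are \<open>take a\<close> and \<open>drop a\<close>.\<close>

definition radon ::
    "'m defpred \<Rightarrow> nat \<Rightarrow> nat \<Rightarrow> 'm list set \<Rightarrow> 'm list set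
      \<Rightarrow> 'm dobj multiset set \<Rightarrow> 'm dobj multiset set" where
  "radon D a b Y S = push D b Y (drop a) \<circ> pull D (a + b) S (take a)"

text \<open>Base change from \<open>{c\<^sub>1}\<close> to \<open>U \<subseteq> M\<^sup>m\<close>: \<open>[W] \<mapsto> [W \<times> U \<rightarrow> U]\<close>.\<close>

definition view_over ::
    "'m defpred \<Rightarrow> nat \<Rightarrow> 'm list set \<Rightarrow> 'm dobj multiset set \<Rightarrow> 'm dobj multiset set" where
  "view_over D m U = SK_induced D m U (\<lambda>(k, W, g). (k + m, cprod W U, drop k))"

definition diagonal :: "'m list set \<Rightarrow> 'm list set" where
  "diagonal X = {x @ x | x. x \<in> X}"

end

theory Submission imports Defs begin

text \<open>
  Write \<open>[W \<rightarrow> X \<times> X]\<close> as a kernel acting on \<open>[Z \<rightarrow> X]\<close> by \<open>Z \<times>\<^sub>X W \<rightarrow> X\<close>, where the fiber product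
  is taken along the first projection and the map to \<open>X\<close> is the second one. Up to associativity of
  the fiber product, the composite of the two Radon transforms is the action of the kernel
  \<open>S \<otimes>\<^sub>Y S' \<rightarrow> X \<times> X\<close> (\<open>radon_class\<close> twice, then the first step of \<open>radon_inversion\<close>). The scissor
  relation splits this kernel over the partition of \<open>X \<times> X\<close> into \<open>X\<^sub>1\<close> and the diagonal.

  For a fixed \<open>Z \<rightarrow> X\<close> and a definable \<open>U \<subseteq> X \<times> X\<close>, the action of kernels over \<open>U\<close> is pull-push along
  the span \<open>U \<leftarrow> Z \<times>\<^sub>X U \<rightarrow> X\<close>, and pull-push along a span of definable maps respects the relations of
  the Grothendieck semigroup (\<open>respects_span\<close>). So the two hypotheses on \<open>B\<^sub>1\<close> and \<open>B\<^sub>2\<close> can be transported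
  along the spans for \<open>U = X\<^sub>1\<close> and \<open>U = \<Delta>\<close>. A constant kernel \<open>W \<times> U\<close> acts by
  \<open>W \<times> (Z \<times>\<^sub>X U)\<close> (\<open>kernel_span_view_SK\<close>). Hence the composite is
  \<open>[Z\<^sub>1 \<times> (Z \<times>\<^sub>X X\<^sub>1)] + [Z\<^sub>1 \<times> (Z \<times>\<^sub>X \<Delta>)] + [Z\<^sub>2 \<times> (Z \<times>\<^sub>X \<Delta>)]\<close>. The first two terms add up to
  \<open>[Z\<^sub>1 \<times> (Z \<times>\<^sub>X (X \<times> X))] = [Z\<^sub>1][Z]\<close> (\<open>square_view_SK\<close>), and the third is \<open>[Z\<^sub>2][Z \<rightarrow> X]\<close> since
  \<open>Z \<times>\<^sub>X \<Delta>\<close> is \<open>Z\<close> (\<open>diagonal_view_SK\<close>). No cancellation takes place, so the argument is valid in a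
  semigroup. Independence of the choice of \<open>Z\<^sub>2\<close> is immediate, because the left-hand side does not
  mention it.

  All definability questions are reduced to a few closure properties of definable sets (the locale
  \<open>definable_sets\<close>). Nearly every isomorphism that occurs permutes, repeats or drops coordinates in one
  direction, and this direction alone has to be shown definable (\<open>isomorphic_coordI\<close>).
\<close>

section \<open>Closure properties of definable sets\<close>

lemma finite_term_vars: "finite (term_vars t)"
  by (induction t) auto

lemma finite_free_vars: "finite (free_vars \<phi>)"
  by (induction \<phi>) (auto simp: finite_term_vars)

lemma term_val_cong: "(\<And>i. i \<in> term_vars t \<Longrightarrow> e i = e' i) \<Longrightarrow> term_val M e t = term_val M e' t"
proof (induction t)
  case (App f ts)
  then have "map (term_val M e) ts = map (term_val M e') ts" by auto
  then show ?case by (simp only: term_val.simps)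
qed auto

lemma sat_cong: "(\<And>i. i \<in> free_vars \<phi> \<Longrightarrow> e i = e' i) \<Longrightarrow> sat M e \<phi> = sat M e' \<phi>"
proof (induction \<phi> arbitrary: e e')
  case (FEq s t)
  then show ?case using term_val_cong[of s e e' M] term_val_cong[of t e e' M] by auto
next
  case (FRel R ts)
  then have "map (term_val M e) ts = map (term_val M e') ts"
    by (auto intro!: term_val_cong)
  then show ?case by (simp only: sat.simps)
next
  case (FNeg \<phi>)
  have "sat M e \<phi> = sat M e' \<phi>" by (rule FNeg.IH) (use FNeg.prems in auto)
  then show ?case by simp
next
  case (FConj \<phi> \<psi>)
  have "sat M e \<phi> = sat M e' \<phi>" by (rule FConj.IH) (use FConj.prems in auto)
  moreover have "sat M e \<psi> = sat M e' \<psi>" by (rule FConj.IH) (use FConj.prems in auto)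
  ultimately show ?case by simp
next
  case (FEx i \<phi>)
  have "sat M (e(i := a)) \<phi> = sat M (e'(i := a)) \<phi>" for a
    by (rule FEx.IH) (use FEx.prems in auto)
  then show ?case by simp
qed

fun rename_term :: "(nat \<Rightarrow> nat) \<Rightarrow> 'f fo_term \<Rightarrow> 'f fo_term" where
  "rename_term \<sigma> (Var i) = Var (\<sigma> i)"
| "rename_term \<sigma> (App f ts) = App f (map (rename_term \<sigma>) ts)"

text \<open>Substitution of variables along an arbitrary \<open>\<sigma>\<close>, which need not be injective. Capture is avoided
  because each bound variable is replaced by one outside the image of the free variables of the
  whole body, the bound one included.\<close>

fun rename :: "(nat \<Rightarrow> nat) \<Rightarrow> ('f, 'r) fo_formula \<Rightarrow> ('f, 'r) fo_formula" where
  "rename \<sigma> (FEq s t) = FEq (rename_term \<sigma> s) (rename_term \<sigma> t)"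
| "rename \<sigma> (FRel R ts) = FRel R (map (rename_term \<sigma>) ts)"
| "rename \<sigma> (FNeg \<phi>) = FNeg (rename \<sigma> \<phi>)"
| "rename \<sigma> (FConj \<phi> \<psi>) = FConj (rename \<sigma> \<phi>) (rename \<sigma> \<psi>)"
| "rename \<sigma> (FEx i \<phi>) =
     (let k = (SOME k. k \<notin> \<sigma> ` free_vars \<phi>) in FEx k (rename (\<sigma>(i := k)) \<phi>))"

lemma fresh_var: "(SOME k. k \<notin> \<sigma> ` free_vars \<phi>) \<notin> \<sigma> ` free_vars \<phi>" for \<sigma> :: "nat \<Rightarrow> nat"
proof -
  have "\<exists>k. k \<notin> \<sigma> ` free_vars \<phi>"
    by (rule ex_new_if_finite) (simp_all add: finite_free_vars)
  then show ?thesis by (rule someI_ex)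
qed

lemma wf_rename_term: "wf_term L t \<Longrightarrow> wf_term L (rename_term \<sigma> t)"
  by (induction t) auto

lemma wf_rename: "wf_formula L \<phi> \<Longrightarrow> wf_formula L (rename \<sigma> \<phi>)"
  by (induction \<phi> arbitrary: \<sigma>) (auto simp: wf_rename_term Let_def)

lemma term_vars_rename: "term_vars (rename_term \<sigma> t) = \<sigma> ` term_vars t"
  by (induction t) auto

lemma free_vars_rename: "free_vars (rename \<sigma> \<phi>) \<subseteq> \<sigma> ` free_vars \<phi>"
proof (induction \<phi> arbitrary: \<sigma>)
  case (FEx i \<phi>)
  define k where "k = (SOME k. k \<notin> \<sigma> ` free_vars \<phi>)"
  have "free_vars (rename (\<sigma>(i := k)) \<phi>) \<subseteq> (\<sigma>(i := k)) ` free_vars \<phi>" by (rule FEx.IH)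
  then show ?case by (auto simp: k_def[symmetric] Let_def split: if_splits)
qed (auto simp: term_vars_rename, blast+)

lemma term_val_rename: "term_val M e (rename_term \<sigma> t) = term_val M (e \<circ> \<sigma>) t"
proof (induction t)
  case (App f ts)
  then have "map (term_val M e) (map (rename_term \<sigma>) ts) = map (term_val M (e \<circ> \<sigma>)) ts"
    by (simp add: comp_def)
  then show ?case by (simp only: term_val.simps rename_term.simps)
qed auto

lemma sat_rename: "sat M e (rename \<sigma> \<phi>) = sat M (e \<circ> \<sigma>) \<phi>"
proof (induction \<phi> arbitrary: e \<sigma>)
  case (FRel R ts)
  have "map (term_val M e) (map (rename_term \<sigma>) ts) = map (term_val M (e \<circ> \<sigma>)) ts"
    by (simp add: term_val_rename)
  then show ?case by (simp only: sat.simps rename.simps)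
next
  case (FEx i \<phi>)
  define k where "k = (SOME k. k \<notin> \<sigma> ` free_vars \<phi>)"
  have k: "k \<notin> \<sigma> ` free_vars \<phi>" unfolding k_def by (rule fresh_var)
  have "sat M (e(k := a) \<circ> \<sigma>(i := k)) \<phi> = sat M ((e \<circ> \<sigma>)(i := a)) \<phi>" for a
    by (rule sat_cong) (use k in auto)
  then show ?case by (simp only: rename.simps Let_def k_def[symmetric] sat.simps FEx.IH)
qed (auto simp: term_val_rename)

lemma definableI:
  assumes "wf_formula L \<phi>" "set ps \<subseteq> A" "free_vars \<phi> \<subseteq> {..<n + length ps}"
    and "\<And>xs. xs \<in> X \<Longrightarrow> length xs = n"
    and "\<And>xs. length xs = n \<Longrightarrow> xs \<in> X \<longleftrightarrow> sat M (\<lambda>i. (xs @ ps) ! i) \<phi>"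
  shows "definable L M A n X"
  unfolding definable_def using assms by blast

text \<open>The parameters \<open>qs\<close> are inserted so that two formulas can be brought to a common list of
  parameters.\<close>

lemma definable_reindex_params:
  assumes "definable L M A m X" "length js = m" "set js \<subseteq> {..<n}"
  shows "\<exists>\<phi> ps. wf_formula L \<phi> \<and> set ps \<subseteq> A \<and> free_vars \<phi> \<subseteq> {..<n + length qs + length ps} \<and>
    (\<forall>xs. length xs = n \<longrightarrow>
       (map ((!) xs) js \<in> X \<longleftrightarrow> sat M (\<lambda>i. (xs @ qs @ ps) ! i) \<phi>))"
proof -
  obtain \<phi> ps where \<phi>: "wf_formula L \<phi>" "set ps \<subseteq> A" "free_vars \<phi> \<subseteq> {..<m + length ps}"
    and X: "X = {xs. length xs = m \<and> sat M (\<lambda>i. (xs @ ps) ! i) \<phi>}"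
    using assms(1) unfolding definable_def by blast
  define \<sigma> where "\<sigma> = (\<lambda>i. if i < m then js ! i else n + length qs + (i - m))"
  have js: "js ! i < n" if "i < m" for i
    using assms that by (metis lessThan_iff nth_mem subsetD)
  have "free_vars (rename \<sigma> \<phi>) \<subseteq> \<sigma> ` {..<m + length ps}"
    using free_vars_rename[of \<sigma> \<phi>] \<phi>(3) by blast
  also have "\<dots> \<subseteq> {..<n + length qs + length ps}"
    using js by (auto simp: \<sigma>_def trans_less_add1)
  finally have "free_vars (rename \<sigma> \<phi>) \<subseteq> {..<n + length qs + length ps}" .
  moreover have "map ((!) xs) js \<in> X \<longleftrightarrow> sat M (\<lambda>i. (xs @ qs @ ps) ! i) (rename \<sigma> \<phi>)"
    if "length xs = n" for xs
  proof -
    have "sat M (\<lambda>i. (map ((!) xs) js @ ps) ! i) \<phi> = sat M ((\<lambda>i. (xs @ qs @ ps) ! i) \<circ> \<sigma>) \<phi>"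
      by (rule sat_cong) (use \<phi>(3) js assms that in \<open>auto simp: \<sigma>_def nth_append\<close>)
    then show ?thesis by (simp add: X sat_rename assms)
  qed
  ultimately show ?thesis using \<phi> wf_rename by blast
qed

lemma map_nth_upt: "length xs = n \<Longrightarrow> map ((!) xs) [0..<n] = xs"
  using map_nth by blast

lemma definable_length: "definable L M A n X \<Longrightarrow> x \<in> X \<Longrightarrow> length x = n"
  by (auto simp: definable_def)

lemma definable_common_params:
  assumes "definable L M A n X" "definable L M A n Y"
  obtains \<phi> \<psi> ps where "wf_formula L \<phi>" "wf_formula L \<psi>" "set ps \<subseteq> A"
    "free_vars \<phi> \<subseteq> {..<n + length ps}" "free_vars \<psi> \<subseteq> {..<n + length ps}"
    "\<And>xs. length xs = n \<Longrightarrow> xs \<in> X \<longleftrightarrow> sat M (\<lambda>i. (xs @ ps) ! i) \<phi>"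
    "\<And>xs. length xs = n \<Longrightarrow> xs \<in> Y \<longleftrightarrow> sat M (\<lambda>i. (xs @ ps) ! i) \<psi>"
proof -
  obtain \<phi> ps where \<phi>: "wf_formula L \<phi>" "set ps \<subseteq> A" "free_vars \<phi> \<subseteq> {..<n + length ps}"
    "X = {xs. length xs = n \<and> sat M (\<lambda>i. (xs @ ps) ! i) \<phi>}"
    using assms(1) unfolding definable_def by blast
  obtain \<psi> qs where \<psi>: "wf_formula L \<psi>" "set qs \<subseteq> A" "free_vars \<psi> \<subseteq> {..<n + length ps + length qs}"
    "\<And>xs. length xs = n \<Longrightarrow> xs \<in> Y \<longleftrightarrow> sat M (\<lambda>i. (xs @ ps @ qs) ! i) \<psi>"
    using definable_reindex_params[OF assms(2), of "[0..<n]" n ps]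
    by (auto simp: map_nth_upt lessThan_atLeast0)
  have "sat M (\<lambda>i. (xs @ ps) ! i) \<phi> = sat M (\<lambda>i. (xs @ ps @ qs) ! i) \<phi>" if "length xs = n" for xs
    by (rule sat_cong) (use \<phi>(3) that in \<open>auto simp: nth_append\<close>)
  with \<phi> \<psi> show ?thesis
    by (intro that[of \<phi> \<psi> "ps @ qs"]) (auto simp: add.assoc)
qed

lemma definable_Un:
  assumes "definable L M A n X" "definable L M A n Y"
  shows "definable L M A n (X \<union> Y)"
proof -
  obtain \<phi> \<psi> ps where *: "wf_formula L \<phi>" "wf_formula L \<psi>" "set ps \<subseteq> A"
    "free_vars \<phi> \<subseteq> {..<n + length ps}" "free_vars \<psi> \<subseteq> {..<n + length ps}"
    "\<And>xs. length xs = n \<Longrightarrow> xs \<in> X \<longleftrightarrow> sat M (\<lambda>i. (xs @ ps) ! i) \<phi>"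
    "\<And>xs. length xs = n \<Longrightarrow> xs \<in> Y \<longleftrightarrow> sat M (\<lambda>i. (xs @ ps) ! i) \<psi>"
    using definable_common_params[OF assms] by blast
  show ?thesis
    by (rule definableI[where \<phi> = "FNeg (FConj (FNeg \<phi>) (FNeg \<psi>))" and ps = ps])
      (use * assms in \<open>auto dest: definable_length\<close>)
qed

lemma definable_Diff:
  assumes "definable L M A n X" "definable L M A n Y"
  shows "definable L M A n (X - Y)"
proof -
  obtain \<phi> \<psi> ps where *: "wf_formula L \<phi>" "wf_formula L \<psi>" "set ps \<subseteq> A"
    "free_vars \<phi> \<subseteq> {..<n + length ps}" "free_vars \<psi> \<subseteq> {..<n + length ps}"
    "\<And>xs. length xs = n \<Longrightarrow> xs \<in> X \<longleftrightarrow> sat M (\<lambda>i. (xs @ ps) ! i) \<phi>"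
    "\<And>xs. length xs = n \<Longrightarrow> xs \<in> Y \<longleftrightarrow> sat M (\<lambda>i. (xs @ ps) ! i) \<psi>"
    using definable_common_params[OF assms] by blast
  show ?thesis
    by (rule definableI[where \<phi> = "FConj \<phi> (FNeg \<psi>)" and ps = ps])
      (use * assms in \<open>auto dest: definable_length\<close>)
qed

lemma definable_reindex:
  assumes "definable L M A m X" "length js = m" "set js \<subseteq> {..<n}"
  shows "definable L M A n {xs. length xs = n \<and> map ((!) xs) js \<in> X}"
proof -
  obtain \<phi> ps where "wf_formula L \<phi>" "set ps \<subseteq> A" "free_vars \<phi> \<subseteq> {..<n + length ps}"
    "\<forall>xs. length xs = n \<longrightarrow> (map ((!) xs) js \<in> X \<longleftrightarrow> sat M (\<lambda>i. (xs @ ps) ! i) \<phi>)"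
    using definable_reindex_params[OF assms, of "[]"] by auto
  then show ?thesis by (intro definableI[of L \<phi> ps]) auto
qed

lemma definable_project:
  assumes "definable L M A (Suc n) X"
  shows "definable L M A n {xs. \<exists>c. xs @ [c] \<in> X}"
proof -
  obtain \<phi> ps where \<phi>: "wf_formula L \<phi>" "set ps \<subseteq> A" "free_vars \<phi> \<subseteq> {..<Suc n + length ps}"
    and X: "X = {xs. length xs = Suc n \<and> sat M (\<lambda>i. (xs @ ps) ! i) \<phi>}"
    using assms unfolding definable_def by blast
  define N where "N = n + length ps"
  \<comment> \<open>The last coordinate becomes the bound variable \<open>N\<close>, beyond all coordinates and parameters, and
    the parameters move down by one to close the gap.\<close>
  define \<sigma> where "\<sigma> = (\<lambda>i. if i < n then i else if i = n then N else i - 1)"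
  show ?thesis
  proof (rule definableI[where \<phi> = "FEx N (rename \<sigma> \<phi>)" and ps = ps])
    have "free_vars (rename \<sigma> \<phi>) \<subseteq> \<sigma> ` {..<Suc n + length ps}"
      using free_vars_rename[of \<sigma> \<phi>] \<phi>(3) by blast
    then show "free_vars (FEx N (rename \<sigma> \<phi>)) \<subseteq> {..<n + length ps}"
      by (fastforce simp: \<sigma>_def N_def split: if_splits)
  next
    fix xs :: "'c list" assume xs: "length xs = n"
    have "sat M (\<lambda>i. ((xs @ [c]) @ ps) ! i) \<phi> = sat M (((\<lambda>i. (xs @ ps) ! i)(N := c)) \<circ> \<sigma>) \<phi>" for c
    proof (rule sat_cong)
      fix i assume "i \<in> free_vars \<phi>"
      then have "i < Suc n + length ps" using \<phi>(3) by auto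
      then show "((xs @ [c]) @ ps) ! i = (((\<lambda>i. (xs @ ps) ! i)(N := c)) \<circ> \<sigma>) i"
        using xs by (auto simp: \<sigma>_def N_def nth_append nth_Cons split: nat.splits)
          (metis diff_Suc_eq_diff_pred diff_Suc_1 diff_commute)+
    qed
    then show "xs \<in> {xs. \<exists>c. xs @ [c] \<in> X} \<longleftrightarrow> sat M (\<lambda>i. (xs @ ps) ! i) (FEx N (rename \<sigma> \<phi>))"
      using xs by (simp add: X sat_rename)
  qed (use \<phi> wf_rename in \<open>auto simp: X\<close>)
qed

lemma definable_eq:
  assumes "i < n" "j < n"
  shows "definable L M A n {xs. length xs = n \<and> xs ! i = xs ! j}"
  by (rule definableI[where \<phi> = "FEq (Var i) (Var j)" and ps = "[]"]) (use assms in auto)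

lemma definable_const:
  assumes "is_constant L c"
  shows "definable L M A 1 {[const_val M c]}"
  by (rule definableI[where \<phi> = "FEq (Var 0) (App c [])" and ps = "[]"])
    (use assms in \<open>auto simp: is_constant_def length_Suc_conv\<close>)


text \<open>The properties of definable sets on which everything below rests; formulas do not occur
  again. In \<open>D_reindex\<close> the index list may repeat and omit coordinates, so it covers permutations,
  preimages under projections, and substitution of equal coordinates.\<close>

locale definable_sets =
  fixes D :: "'m defpred"
  assumes D_length: "D n X \<Longrightarrow> x \<in> X \<Longrightarrow> length x = n"
    and D_Un: "D n X \<Longrightarrow> D n Y \<Longrightarrow> D n (X \<union> Y)"
    and D_Diff: "D n X \<Longrightarrow> D n Y \<Longrightarrow> D n (X - Y)"
    and D_reindex: "D m X \<Longrightarrow> length js = m \<Longrightarrow> set js \<subseteq> {..<n} \<Longrightarrow>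
      D n {xs. length xs = n \<and> map ((!) xs) js \<in> X}"
    and D_project1: "D (Suc n) X \<Longrightarrow> D n {xs. \<exists>c. xs @ [c] \<in> X}"
    and D_eq: "i < n \<Longrightarrow> j < n \<Longrightarrow> D n {xs. length xs = n \<and> xs ! i = xs ! j}"

lemma definable_sets_definable: "definable_sets (definable L M A)"
  by unfold_locales
    (fact definable_length definable_Un definable_Diff definable_reindex definable_project definable_eq)+

section \<open>Definable maps\<close>

text \<open>Maps that list some of the coordinates of their argument, possibly repeated. They are closed under
  the list operations \<open>take\<close>, \<open>drop\<close> and \<open>@\<close>, so that the map behind a list expression is recognized as
  definable from its syntax.\<close>

definition coord :: "nat \<Rightarrow> nat \<Rightarrow> ('m list \<Rightarrow> 'm list) \<Rightarrow> bool" where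
  "coord n m h \<longleftrightarrow> (\<exists>js. length js = m \<and> set js \<subseteq> {..<n} \<and>
     (\<forall>x. length x = n \<longrightarrow> h x = map ((!) x) js))"

lemma coord_id: "coord n n (\<lambda>x. x)"
  unfolding coord_def by (rule exI[of _ "[0..<n]"]) (auto simp: map_nth_upt)

lemma coord_take: "coord n m h \<Longrightarrow> k \<le> m \<Longrightarrow> coord n k (\<lambda>x. take k (h x))"
  unfolding coord_def
  by (elim exE, rule_tac x = "take k js" in exI) (auto simp: take_map dest: in_set_takeD)

lemma coord_drop: "coord n m h \<Longrightarrow> k + k' = m \<Longrightarrow> coord n k' (\<lambda>x. drop k (h x))"
  unfolding coord_def
  by (elim exE, rule_tac x = "drop k js" in exI) (auto simp: drop_map dest: in_set_dropD)

lemma coord_append: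
  "coord n m h \<Longrightarrow> coord n m' h' \<Longrightarrow> m + m' = k \<Longrightarrow> coord n k (\<lambda>x. h x @ h' x)"
  unfolding coord_def
  by (elim exE, rule_tac x = "js @ jsa" in exI) auto

lemmas coord_intros = coord_append coord_take coord_drop coord_id

lemma cprodI: "x \<in> X \<Longrightarrow> y \<in> Y \<Longrightarrow> x @ y \<in> cprod X Y"
  unfolding cprod_def by blast

lemma cprodE: "z \<in> cprod X Y \<Longrightarrow> (\<And>x y. z = x @ y \<Longrightarrow> x \<in> X \<Longrightarrow> y \<in> Y \<Longrightarrow> P) \<Longrightarrow> P"
  unfolding cprod_def by blast

lemma fiber_prodI: "x \<in> X \<Longrightarrow> y \<in> Y \<Longrightarrow> f x = g y \<Longrightarrow> x @ y \<in> fiber_prod X f Y g"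
  unfolding fiber_prod_def by blast

lemma fiber_prodE:
  "z \<in> fiber_prod X f Y g \<Longrightarrow>
    (\<And>x y. z = x @ y \<Longrightarrow> x \<in> X \<Longrightarrow> y \<in> Y \<Longrightarrow> f x = g y \<Longrightarrow> P) \<Longrightarrow> P"
  unfolding fiber_prod_def by blast

lemma mem_cprod:
  assumes "\<And>x. x \<in> X \<Longrightarrow> length x = n"
  shows "z \<in> cprod X Y \<longleftrightarrow> take n z \<in> X \<and> drop n z \<in> Y"
proof
  assume "take n z \<in> X \<and> drop n z \<in> Y"
  then have "take n z @ drop n z \<in> cprod X Y" unfolding cprod_def by blast
  then show "z \<in> cprod X Y" by simp
qed (auto simp: cprod_def assms)

lemma mem_fiber_prod:
  assumes "\<And>x. x \<in> X \<Longrightarrow> length x = n"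
  shows "z \<in> fiber_prod X f Y g \<longleftrightarrow> take n z \<in> X \<and> drop n z \<in> Y \<and> f (take n z) = g (drop n z)"
proof
  assume "take n z \<in> X \<and> drop n z \<in> Y \<and> f (take n z) = g (drop n z)"
  then have "take n z @ drop n z \<in> fiber_prod X f Y g" unfolding fiber_prod_def by blast
  then show "z \<in> fiber_prod X f Y g" by simp
qed (auto simp: fiber_prod_def assms)

context definable_sets
begin

lemma D_Int: "D n X \<Longrightarrow> D n Y \<Longrightarrow> D n (X \<inter> Y)"
  using D_Diff[of n X "X - Y"] D_Diff[of n X Y] by (simp add: Diff_Diff_Int)

lemma D_empty: "D n X \<Longrightarrow> D n {}"
  using D_Diff[of n X X] by simp

lemma D_project: "D (n + k) X \<Longrightarrow> D n {xs. \<exists>ys. length ys = k \<and> xs @ ys \<in> X}"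
proof (induction k arbitrary: X)
  case (Suc k)
  then have "D n {xs. \<exists>ys. length ys = k \<and> xs @ ys \<in> {zs. \<exists>c. zs @ [c] \<in> X}}"
    by (intro Suc.IH D_project1) simp
  also have "{xs. \<exists>ys. length ys = k \<and> xs @ ys \<in> {zs. \<exists>c. zs @ [c] \<in> X}} =
      {xs. \<exists>ys. length ys = Suc k \<and> xs @ ys \<in> X}"
    by (auto simp: length_Suc_conv_rev)
  finally show ?case .
qed simp

lemma D_vimage_coord:
  assumes "D m X" "coord n m h"
  shows "D n {x. length x = n \<and> h x \<in> X}"
proof -
  obtain js where js: "length js = m" "set js \<subseteq> {..<n}"
    "\<forall>x. length x = n \<longrightarrow> h x = map ((!) x) js"
    using assms(2) unfolding coord_def by blast
  have "D n {xs. length xs = n \<and> map ((!) xs) js \<in> X}"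
    using D_reindex assms(1) js by blast
  also have "{xs. length xs = n \<and> map ((!) xs) js \<in> X} = {x. length x = n \<and> h x \<in> X}"
    using js(3) by auto
  finally show ?thesis .
qed

text \<open>One equation between two coordinates is added for every entry of the index list.\<close>

lemma D_graph_nth:
  assumes "D n X" "set js \<subseteq> {..<n}"
  shows "D (n + length js) {x @ map ((!) x) js | x. x \<in> X}"
  using assms(2)
proof (induction js rule: rev_induct)
  case Nil
  then show ?case using assms(1) by simp
next
  case (snoc j js)
  let ?m = "n + length js"
  have j: "j < n" "set js \<subseteq> {..<n}" using snoc.prems by auto
  let ?G = "{x @ map ((!) x) js | x. x \<in> X}"
  have "D (Suc ?m) {w. length w = Suc ?m \<and> take ?m w \<in> ?G}"
    by (rule D_vimage_coord[OF snoc.IH[OF j(2)]]) (rule coord_intros | simp)+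
  then have "D (Suc ?m) ({w. length w = Suc ?m \<and> take ?m w \<in> ?G} \<inter>
      {w. length w = Suc ?m \<and> w ! ?m = w ! j})"
    using j by (intro D_Int D_eq) auto
  also have "{w. length w = Suc ?m \<and> take ?m w \<in> ?G} \<inter> {w. length w = Suc ?m \<and> w ! ?m = w ! j}
      = {x @ map ((!) x) (js @ [j]) | x. x \<in> X}" (is "?A = ?B")
  proof (intro equalityI subsetI)
    fix w assume w: "w \<in> ?A"
    then obtain x where x: "x \<in> X" "take ?m w = x @ map ((!) x) js" by auto
    have "w = take ?m w @ [w ! ?m]"
      using w take_Suc_conv_app_nth[of ?m w] by simp
    then have "w = x @ map ((!) x) js @ [w ! ?m]" using x by simp
    moreover have "w ! ?m = x ! j"
    proof -
      have "w ! ?m = take ?m w ! j" using w j by simp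
      also have "\<dots> = x ! j" unfolding x(2) using j D_length[OF assms(1) x(1)]
        by (simp add: nth_append)
      finally show ?thesis .
    qed
    ultimately show "w \<in> ?B" using x(1) by auto
  next
    fix w assume "w \<in> ?B"
    then obtain x where x: "x \<in> X" "w = x @ map ((!) x) (js @ [j])" by blast
    with D_length[OF assms(1) x(1)] j show "w \<in> ?A"
      by (auto simp: nth_append)
  qed
  finally show ?case by simp
qed

lemma D_graph_coord:
  assumes "D n X" "coord n m h"
  shows "D (n + m) {x @ h x | x. x \<in> X}"
proof -
  obtain js where js: "length js = m" "set js \<subseteq> {..<n}"
    "\<forall>x. length x = n \<longrightarrow> h x = map ((!) x) js"
    using assms(2) unfolding coord_def by blast
  have "map ((!) x) js = h x" if "x \<in> X" for x
    using js(3) D_length[OF assms(1) that] by simp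
  then have "(\<lambda>x. x @ map ((!) x) js) ` X = (\<lambda>x. x @ h x) ` X"
    by (intro image_cong) simp_all
  then have "{x @ map ((!) x) js | x. x \<in> X} = {x @ h x | x. x \<in> X}"
    by (simp only: Setcompr_eq_image)
  then show ?thesis using D_graph_nth[OF assms(1) js(2)] by (simp only: js(1))
qed

lemma D_cprod:
  assumes "D n X" "D m Y"
  shows "D (n + m) (cprod X Y)"
proof -
  have "D (n + m) ({w. length w = n + m \<and> take n w \<in> X} \<inter> {w. length w = n + m \<and> drop n w \<in> Y})"
    by (intro D_Int D_vimage_coord[OF assms(1)] D_vimage_coord[OF assms(2)];
        (rule coord_intros | simp)+)
  also have "\<dots> = cprod X Y"
    by (auto simp: cprod_def D_length[OF assms(1)] D_length[OF assms(2)])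
      (metis append_take_drop_id)
  finally show ?thesis .
qed

lemma definable_map_coord:
  "D n X \<Longrightarrow> D m Y \<Longrightarrow> coord n m h \<Longrightarrow> h \<in> X \<rightarrow> Y \<Longrightarrow> definable_map D n X m Y h"
  unfolding definable_map_def by (simp add: D_graph_coord)

lemma definable_map_cong:
  assumes "definable_map D n X m Y f" "\<And>x. x \<in> X \<Longrightarrow> f x = g x"
  shows "definable_map D n X m Y g"
proof -
  have "(\<lambda>x. x @ f x) ` X = (\<lambda>x. x @ g x) ` X" by (intro image_cong) (simp_all add: assms(2))
  then have "{x @ g x | x. x \<in> X} = {x @ f x | x. x \<in> X}" by (simp only: Setcompr_eq_image)
  moreover have "g \<in> X \<rightarrow> Y" using assms by (auto simp: definable_map_def Pi_iff)
  ultimately show ?thesis using assms(1) unfolding definable_map_def by (simp only: simp_thms)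
qed

text \<open>Because all points of \<open>X\<close> have the same length, a concatenation determines its two parts.\<close>

lemma graphD:
  assumes "x @ y \<in> {x @ f x | x. x \<in> X}" "length x = n" "\<And>x. x \<in> X \<Longrightarrow> length x = n"
  shows "x \<in> X \<and> y = f x"
proof -
  obtain x' where x': "x' \<in> X" "x @ y = x' @ f x'" using assms(1) by blast
  then have "length x = length x'" using assms by metis
  then show "x \<in> X \<and> y = f x" using x' by simp
qed

lemma definable_map_restrict:
  assumes f: "definable_map D n X m Y f" and "D n X'" "X' \<subseteq> X"
  shows "definable_map D n X' m Y f"
proof -
  note len = D_length[OF assms(2)]
  have "D (n + m) ({x @ f x | x. x \<in> X} \<inter> {w. length w = n + m \<and> take n w \<in> X'})"
    by (rule D_Int[OF _ D_vimage_coord[OF assms(2)]])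
      (use f in \<open>simp add: definable_map_def\<close>, (rule coord_intros | simp)+)
  also have "\<dots> = {x @ f x | x. x \<in> X'}"
    using f assms(3) D_length[of n X] D_length[of m Y] by (fastforce simp: definable_map_def)
  finally show ?thesis using f assms unfolding definable_map_def by auto
qed

lemma definable_map_comp:
  assumes f: "definable_map D n X m Y f" and g: "definable_map D m Y k Z g"
  shows "definable_map D n X k Z (\<lambda>x. g (f x))"
proof -
  have *: "D n X" "D m Y" "D k Z" "f \<in> X \<rightarrow> Y" "g \<in> Y \<rightarrow> Z"
    and gf: "D (n + m) {x @ f x | x. x \<in> X}" and gg: "D (m + k) {y @ g y | y. y \<in> Y}"
    using f g by (auto simp: definable_map_def)
  note len = *(1,2,3)[THEN D_length]
  let ?E = "{w. length w = n + k + m \<and> take n w @ drop (n + k) w \<in> {x @ f x | x. x \<in> X}} \<inter>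
    {w. length w = n + k + m \<and> drop (n + k) w @ take k (drop n w) \<in> {y @ g y | y. y \<in> Y}}"
  have "D (n + k + m) ?E"
    by (intro D_Int D_vimage_coord[OF gf] D_vimage_coord[OF gg]; (rule coord_intros | simp)+)
  then have "D (n + k) {xs. \<exists>y. length y = m \<and> xs @ y \<in> ?E}" by (rule D_project)
  also have "{xs. \<exists>y. length y = m \<and> xs @ y \<in> ?E} = {x @ g (f x) | x. x \<in> X}"
  proof (intro equalityI subsetI)
    fix u assume "u \<in> {xs. \<exists>y. length y = m \<and> xs @ y \<in> ?E}"
    then obtain y where y: "length y = m" "u @ y \<in> ?E" by blast
    define x z where "x = take n u" and "z = drop n u"
    have u: "u = x @ z" "length x = n" "length z = k"
      using y by (auto simp: x_def z_def)
    have xy: "x @ y \<in> {x @ f x | x. x \<in> X}" and yz: "y @ z \<in> {y @ g y | y. y \<in> Y}"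
      using y(2) u y(1) by simp_all
    show "u \<in> {x @ g (f x) | x. x \<in> X}"
      using graphD[OF xy u(2) len(1)] graphD[OF yz y(1) len(2)] u(1) by blast
  next
    fix u assume "u \<in> {x @ g (f x) | x. x \<in> X}"
    then obtain x where x: "x \<in> X" "u = x @ g (f x)" by blast
    have l: "length x = n" "length (f x) = m" "length (g (f x)) = k" "f x \<in> Y"
      using x len * by (auto simp: Pi_iff)
    have "u @ f x \<in> ?E" using x l by auto
    then show "u \<in> {xs. \<exists>y. length y = m \<and> xs @ y \<in> ?E}" using l by blast
  qed
  finally show ?thesis using * unfolding definable_map_def by auto
qed

lemma definable_map_append:
  assumes f: "definable_map D n X m Y f" and g: "definable_map D n X k Z g"
    and W: "D (m + k) W" "\<And>x. x \<in> X \<Longrightarrow> f x @ g x \<in> W"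
  shows "definable_map D n X (m + k) W (\<lambda>x. f x @ g x)"
proof -
  have *: "D n X" "D m Y" "D k Z" "f \<in> X \<rightarrow> Y" "g \<in> X \<rightarrow> Z"
    and gf: "D (n + m) {x @ f x | x. x \<in> X}" and gg: "D (n + k) {x @ g x | x. x \<in> X}"
    using f g by (auto simp: definable_map_def)
  note len = *(1,2,3)[THEN D_length]
  let ?E = "{w. length w = n + (m + k) \<and> take n w @ take m (drop n w) \<in> {x @ f x | x. x \<in> X}} \<inter>
    {w. length w = n + (m + k) \<and> take n w @ drop (n + m) w \<in> {x @ g x | x. x \<in> X}}"
  have "D (n + (m + k)) ?E"
    by (intro D_Int D_vimage_coord[OF gf] D_vimage_coord[OF gg]; (rule coord_intros | simp)+)
  also have "?E = {x @ f x @ g x | x. x \<in> X}"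
  proof (intro equalityI subsetI)
    fix u assume u: "u \<in> ?E"
    define x y z where "x = take n u" and "y = take m (drop n u)" and "z = drop (n + m) u"
    have l: "u = x @ y @ z" "length x = n"
      using u by (auto simp: x_def y_def z_def) (metis append_take_drop_id drop_drop add.commute)
    have xy: "x @ y \<in> {x @ f x | x. x \<in> X}" and xz: "x @ z \<in> {x @ g x | x. x \<in> X}"
      using u unfolding x_def y_def z_def by simp_all
    show "u \<in> {x @ f x @ g x | x. x \<in> X}"
      using graphD[OF xy l(2) len(1)] graphD[OF xz l(2) len(1)] l(1) by blast
  next
    fix u assume "u \<in> {x @ f x @ g x | x. x \<in> X}"
    then obtain x where x: "x \<in> X" "u = x @ f x @ g x" by blast
    have l: "length x = n" "length (f x) = m" "length (g x) = k"
      using x len * by (auto simp: Pi_iff)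
    then show "u \<in> ?E" using x by auto
  qed
  finally show ?thesis using * W unfolding definable_map_def by auto
qed

text \<open>The intersection of the two graphs, projected to \<open>X\<close>, is the set where the maps agree; no definable
  equality on the target has to be constructed.\<close>

lemma D_equalizer:
  assumes f: "definable_map D n X m Y f" and g: "definable_map D n X m Y g"
  shows "D n {x \<in> X. f x = g x}"
proof -
  have *: "D n X" "D m Y" "f \<in> X \<rightarrow> Y"
    and E: "D (n + m) ({x @ f x | x. x \<in> X} \<inter> {x @ g x | x. x \<in> X})"
    using f g by (auto simp: definable_map_def intro: D_Int)
  note len = *(1,2)[THEN D_length]
  have "{xs. \<exists>y. length y = m \<and> xs @ y \<in> {x @ f x | x. x \<in> X} \<inter> {x @ g x | x. x \<in> X}}
      = {x \<in> X. f x = g x}" (is "?A = ?B")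
  proof (intro equalityI subsetI)
    fix x assume "x \<in> ?A"
    then obtain y where y: "length y = m" "x @ y \<in> {x @ f x | x. x \<in> X}"
      "x @ y \<in> {x @ g x | x. x \<in> X}" by blast
    have l: "length x = n" using D_length[OF E IntI[OF y(2,3)]] y(1) by simp
    show "x \<in> ?B" using graphD[OF y(2) l len(1)] graphD[OF y(3) l len(1)] by simp
  next
    fix x assume "x \<in> ?B"
    then have x: "x \<in> X" "f x = g x" by simp_all
    have "length (f x) = m" using x(1) * len by (simp add: Pi_iff)
    moreover have "x @ f x \<in> {x @ f x | x. x \<in> X}" using x(1) by blast
    moreover have "x @ f x \<in> {x @ g x | x. x \<in> X}" using x by (metis (mono_tags) mem_Collect_eq)
    ultimately show "x \<in> ?A" by blast
  qed
  then show ?thesis using D_project[OF E] by simp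
qed

lemma definable_map_take:
  "D n X \<Longrightarrow> D m Y \<Longrightarrow> m \<le> n \<Longrightarrow> take m \<in> X \<rightarrow> Y \<Longrightarrow> definable_map D n X m Y (take m)"
  by (rule definable_map_coord) (use coord_take[OF coord_id] in auto)

lemma definable_map_drop:
  "D n X \<Longrightarrow> D m Y \<Longrightarrow> k + m = n \<Longrightarrow> drop k \<in> X \<rightarrow> Y \<Longrightarrow> definable_map D n X m Y (drop k)"
  by (rule definable_map_coord) (use coord_drop[OF coord_id] in auto)

lemma D_fiber_prod:
  assumes f: "definable_map D n X k Z f" and g: "definable_map D m Y k Z g"
  shows "D (n + m) (fiber_prod X f Y g)"
proof -
  have *: "D n X" "D m Y" using f g by (auto simp: definable_map_def)
  note len = *[THEN D_length]
  have "definable_map D (n + m) (cprod X Y) n X (take n)"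
    by (rule definable_map_take) (use * D_cprod len in \<open>auto simp: cprod_def\<close>)
  moreover have "definable_map D (n + m) (cprod X Y) m Y (drop n)"
    by (rule definable_map_drop) (use * D_cprod len in \<open>auto simp: cprod_def\<close>)
  ultimately have "D (n + m) {w \<in> cprod X Y. f (take n w) = g (drop n w)}"
    using D_equalizer definable_map_comp f g by blast
  also have "\<dots> = fiber_prod X f Y g"
    by (auto simp: mem_cprod[of X n] mem_fiber_prod[of X n] len)
  finally show ?thesis .
qed

lemma definable_map_const:
  assumes "D n X" "D m {c}"
  shows "definable_map D n X m {c} (\<lambda>_. c)"
proof -
  have "cprod X {c} = {x @ c | x. x \<in> X}" by (auto simp: cprod_def)
  then show ?thesis using D_cprod[OF assms] assms by (simp add: definable_map_def)
qed

end

section \<open>Operations compatible with the Grothendieck relations\<close>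

text \<open>Pull-push along a span \<open>Z \<leftarrow>f\<midarrow> V \<midarrow>h\<rightarrow> Z'\<close> with \<open>V \<subseteq> M\<^sup>d\<close>. Inverse images, base change from a point, fiber
  products with a fixed object and the action of kernels are all of this form, up to
  isomorphism.\<close>

definition span_obj ::
    "'m list set \<Rightarrow> ('m list \<Rightarrow> 'm list) \<Rightarrow> ('m list \<Rightarrow> 'm list) \<Rightarrow> nat \<Rightarrow> 'm dobj \<Rightarrow> 'm dobj" where
  "span_obj V f h d = (\<lambda>(k, W, g). (k + d, fiber_prod W g V f, \<lambda>x. h (drop k x)))"

context definable_sets
begin

lemma definable_map_id: "D n X \<Longrightarrow> definable_map D n X n X (\<lambda>x. x)"
  by (rule definable_map_coord) (simp_all add: coord_id)

lemma mem_Def: "(n, X, f) \<in> Def D m Z \<longleftrightarrow> definable_map D n X m Z f"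
  by (simp add: Def_def)

lemma Def_D: "(n, X, f) \<in> Def D m Z \<Longrightarrow> D n X"
  by (simp add: Def_def definable_map_def)

lemma Def_length: "(n, X, f) \<in> Def D m Z \<Longrightarrow> x \<in> X \<Longrightarrow> length x = n"
  using Def_D D_length by blast

lemma Def_Pi: "(n, X, f) \<in> Def D m Z \<Longrightarrow> x \<in> X \<Longrightarrow> f x \<in> Z"
  by (auto simp: Def_def definable_map_def)

lemma Def_restrict: "(n, X, f) \<in> Def D m Z \<Longrightarrow> D n Y \<Longrightarrow> Y \<subseteq> X \<Longrightarrow> (n, Y, f) \<in> Def D m Z"
  unfolding mem_Def by (rule definable_map_restrict)

text \<open>The graph of the inverse of a definable bijection is the graph of the bijection with its two blocks of
  coordinates exchanged. Hence \<open>k\<close> need not be assumed definable.\<close>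

lemma isomorphicI:
  assumes X: "(n, X, f) \<in> Def D m Z" and X': "(n', X', f') \<in> Def D m Z"
    and h: "definable_map D n X n' X' h"
    and k: "\<And>x. x \<in> X' \<Longrightarrow> k x \<in> X" "\<And>x. x \<in> X \<Longrightarrow> k (h x) = x" "\<And>x. x \<in> X' \<Longrightarrow> h (k x) = x"
    and over: "\<And>x. x \<in> X \<Longrightarrow> f' (h x) = f x"
  shows "isomorphic D (n, X, f) (n', X', f')"
proof -
  have *: "D n X" "D n' X'" "D (n + n') {x @ h x | x. x \<in> X}" "\<And>x. x \<in> X \<Longrightarrow> h x \<in> X'"
    using h by (auto simp: definable_map_def)
  note len = *(1,2)[THEN D_length]
  have "D (n' + n) {w. length w = n' + n \<and> drop n' w @ take n' w \<in> {x @ h x | x. x \<in> X}}"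
    by (rule D_vimage_coord[OF *(3)]) (rule coord_intros | simp)+
  also have "{w. length w = n' + n \<and> drop n' w @ take n' w \<in> {x @ h x | x. x \<in> X}}
      = {y @ k y | y. y \<in> X'}" (is "?A = ?B")
  proof (intro equalityI subsetI)
    fix w assume w: "w \<in> ?A"
    have l: "length (drop n' w) = n" using w by simp
    have "drop n' w @ take n' w \<in> {x @ h x | x. x \<in> X}" using w by simp
    from graphD[OF this l len(1)] have x: "drop n' w \<in> X" "take n' w = h (drop n' w)" by simp_all
    have "w = take n' w @ drop n' w" by simp
    also have "\<dots> = h (drop n' w) @ k (h (drop n' w))" using x k(2) by simp
    finally show "w \<in> ?B" using *(4) x(1) by blast
  next
    fix w assume "w \<in> ?B"
    then obtain y where y: "y \<in> X'" "w = y @ k y" by blast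
    have "k y @ h (k y) \<in> {x @ h x | x. x \<in> X}" using k(1) y(1) by blast
    then show "w \<in> ?A" using y k len by simp
  qed
  finally have "definable_map D n' X' n X k"
    using * k(1) by (simp add: definable_map_def)
  moreover have "f (k x) = f' x" if "x \<in> X'" for x
    using over[of "k x"] k that by simp
  ultimately show ?thesis
    using h over k(2,3) unfolding isomorphic.simps morphism.simps by blast
qed

lemma isomorphic_coordI:
  assumes X: "(n, X, f) \<in> Def D m Z" and X': "(n', X', f') \<in> Def D m Z"
    and h: "coord n n' h" "\<And>x. x \<in> X \<Longrightarrow> h x \<in> X'"
    and k: "\<And>x. x \<in> X' \<Longrightarrow> k x \<in> X" "\<And>x. x \<in> X \<Longrightarrow> k (h x) = x" "\<And>x. x \<in> X' \<Longrightarrow> h (k x) = x"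
    and over: "\<And>x. x \<in> X \<Longrightarrow> f' (h x) = f x"
  shows "isomorphic D (n, X, f) (n', X', f')"
  by (rule isomorphicI[OF X X' definable_map_coord[OF Def_D[OF X] Def_D[OF X'] h(1)] k over])
    (use h in auto)

lemma isomorphic_cong:
  assumes "(n, X, f) \<in> Def D m Z" "\<And>x. x \<in> X \<Longrightarrow> f x = g x"
  shows "isomorphic D (n, X, f) (n, X, g)"
  by (rule isomorphic_coordI[where m = m and Z = Z, OF assms(1) _ coord_id, where k = "\<lambda>x. x"])
    (use assms definable_map_cong[of n X m Z f g] in \<open>simp_all add: mem_Def\<close>)

lemma SK_rel_free: "(u, v) \<in> SK_rel D m Z \<Longrightarrow> u \<in> free_SK D m Z \<and> v \<in> free_SK D m Z"
proof (induction rule: SK_rel.induct)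
  case (scissor n X f Y Y')
  have "(n, W, f) \<in> Def D m Z" if "W \<in> {Y \<union> Y', Y \<inter> Y', Y, Y'}" for W
    by (rule Def_restrict[OF scissor(1)])
      (use that scissor D_Un[OF scissor(2,4)] D_Int[OF scissor(2,4)] in auto)
  then show ?case by (simp add: free_SK_def)
qed (simp_all add: free_SK_def)

lemma SK_rel_add:
  assumes "(u, v) \<in> SK_rel D m Z" "(u', v') \<in> SK_rel D m Z"
  shows "(u + u', v + v') \<in> SK_rel D m Z"
proof -
  have "(u + u', v + u') \<in> SK_rel D m Z" using assms SK_rel_free SK_rel.add by blast
  moreover have "(u' + v, v' + v) \<in> SK_rel D m Z" using assms SK_rel_free SK_rel.add by blast
  ultimately show ?thesis by (metis SK_rel.trans add.commute)
qed

lemma SK_rel_class_eq: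
  "(u, v) \<in> SK_rel D m Z \<Longrightarrow> SK_rel D m Z `` {u} = SK_rel D m Z `` {v}"
  by (auto intro: SK_rel.trans SK_rel.sym)

lemma SK_rel_class_mem: "u \<in> free_SK D m Z \<Longrightarrow> u \<in> SK_rel D m Z `` {u}"
  by (auto intro: SK_rel.refl)

lemma SK_rel_class_eqD:
  "SK_rel D m Z `` {u} = SK_rel D m Z `` {v} \<Longrightarrow> v \<in> free_SK D m Z \<Longrightarrow> (u, v) \<in> SK_rel D m Z"
  using SK_rel_class_mem by blast

text \<open>The operations on classes are unions over all representatives; for a well-defined operation
  any one representative computes the union.\<close>

lemma Union_class:
  assumes "u \<in> free_SK D m Z"
    and "\<And>v. (u, v) \<in> SK_rel D m Z \<Longrightarrow> F v = F u"
  shows "(\<Union>v\<in>SK_rel D m Z `` {u}. F v) = F u"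
  using assms SK_rel_class_mem[OF assms(1)] by blast

lemma SK_add_class:
  assumes "u \<in> free_SK D m Z" "v \<in> free_SK D m Z"
  shows "SK_rel D m Z `` {u} \<oplus>\<^bsub>SK0 D m Z\<^esub> SK_rel D m Z `` {v} = SK_rel D m Z `` {u + v}"
proof -
  have "(\<Union>v'\<in>SK_rel D m Z `` {v}. SK_rel D m Z `` {u' + v'}) = SK_rel D m Z `` {u' + v}"
    if "u' \<in> free_SK D m Z" for u'
    by (rule Union_class[OF assms(2) SK_rel_class_eq[OF SK_rel_add[OF SK_rel.refl[OF that]
          SK_rel.sym]]])
  then have "(\<Union>u'\<in>SK_rel D m Z `` {u}. \<Union>v'\<in>SK_rel D m Z `` {v}. SK_rel D m Z `` {u' + v'}) =
      (\<Union>u'\<in>SK_rel D m Z `` {u}. SK_rel D m Z `` {u' + v})"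
    using SK_rel_free by (intro SUP_cong) auto
  also have "\<dots> = SK_rel D m Z `` {u + v}"
    by (rule Union_class[OF assms(1) SK_rel_class_eq[OF SK_rel_add[OF SK_rel.sym
          SK_rel.refl[OF assms(2)]]]])
  finally show ?thesis by (simp add: SK0_def)
qed

definition respects_SK :: "nat \<Rightarrow> 'm list set \<Rightarrow> nat \<Rightarrow> 'm list set \<Rightarrow> ('m dobj \<Rightarrow> 'm dobj) \<Rightarrow> bool" where
  "respects_SK m Z m' Z' F \<longleftrightarrow>
     (\<forall>u v. (u, v) \<in> SK_rel D m Z \<longrightarrow> (image_mset F u, image_mset F v) \<in> SK_rel D m' Z')"

lemma respects_SKD:
  "respects_SK m Z m' Z' F \<Longrightarrow> (u, v) \<in> SK_rel D m Z \<Longrightarrow>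
    (image_mset F u, image_mset F v) \<in> SK_rel D m' Z'"
  by (simp add: respects_SK_def)

lemma SK_induced_class:
  assumes "u \<in> free_SK D m Z" "respects_SK m Z m' Z' F"
  shows "SK_induced D m' Z' F (SK_rel D m Z `` {u}) = SK_rel D m' Z' `` {image_mset F u}"
  unfolding SK_induced_def
  by (rule Union_class[OF assms(1) SK_rel_class_eq[OF respects_SKD[OF assms(2) SK_rel.sym]]])

text \<open>The generators of the congruence involve either a single object, an isomorphism, or subsets of one
  object with the same map. An operation that is functorial on isomorphisms and acts on the underlying
  sets by a Boolean homomorphism, with the ambient dimension and the map depending only on those of the
  argument, therefore preserves the congruence.\<close>

lemma respects_SKI:
  assumes F: "\<And>n X f. (n, X, f) \<in> Def D m Z \<Longrightarrow> F (n, X, f) = (N n, G n X f, H n f)"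
    and Def: "\<And>W. W \<in> Def D m Z \<Longrightarrow> F W \<in> Def D m' Z'"
    and iso: "\<And>W W'. W \<in> Def D m Z \<Longrightarrow> W' \<in> Def D m Z \<Longrightarrow> isomorphic D W W' \<Longrightarrow>
      isomorphic D (F W) (F W')"
    and empty: "\<And>n f. G n {} f = {}"
    and Un: "\<And>n Y Y' f. G n (Y \<union> Y') f = G n Y f \<union> G n Y' f"
    and Int: "\<And>n Y Y' f. D n Y \<Longrightarrow> D n Y' \<Longrightarrow> G n (Y \<inter> Y') f = G n Y f \<inter> G n Y' f"
  shows "respects_SK m Z m' Z' F"
  unfolding respects_SK_def
proof (intro allI impI)
  fix u v assume "(u, v) \<in> SK_rel D m Z"
  then show "(image_mset F u, image_mset F v) \<in> SK_rel D m' Z'"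
  proof (induction rule: SK_rel.induct)
    case (empty n f)
    then show ?case using SK_rel.empty[of "N n" "H n f"] Def[of "(n, {}, f)"] F[of n "{}" f]
      by (simp add: assms(4))
  next
    case (iso W W')
    then have "({#F W#}, {#F W'#}) \<in> SK_rel D m' Z'" by (intro SK_rel.iso Def assms(3))
    then show ?case by simp
  next
    case (scissor n X f Y Y')
    have Y: "(n, Y, f) \<in> Def D m Z" "(n, Y', f) \<in> Def D m Z" "(n, Y \<union> Y', f) \<in> Def D m Z"
      "(n, Y \<inter> Y', f) \<in> Def D m Z"
      by (rule Def_restrict[OF scissor(1)]; use scissor in \<open>auto intro: D_Un D_Int\<close>)+
    have FX: "(N n, G n X f, H n f) \<in> Def D m' Z'" using Def[OF scissor(1)] F[OF scissor(1)] by simp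
    have FY: "D (N n) (G n Y f)" "D (N n) (G n Y' f)"
      using Def[OF Y(1)] Def[OF Y(2)] unfolding F[OF Y(1)] F[OF Y(2)]
      by (blast dest: Def_D)+
    have mono: "G n Y f \<subseteq> G n X f" "G n Y' f \<subseteq> G n X f"
      using Un[of n Y X f] Un[of n Y' X f] scissor by (auto simp: Un_absorb1)
    show ?case
      using SK_rel.scissor[OF FX FY(1) mono(1) FY(2) mono(2)]
      by (simp add: F Y Un Int[OF scissor(2,4)])
  next
    case (refl u)
    then show ?case by (intro SK_rel.refl) (auto simp: free_SK_def Def)
  next
    case (sym u v)
    then show ?case by (rule_tac SK_rel.sym)
  next
    case (trans u v w)
    then show ?case by (blast intro: SK_rel.trans)
  next
    case (add u v w)
    then have "(image_mset F u + image_mset F w, image_mset F v + image_mset F w) \<in> SK_rel D m' Z'"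
      by (intro SK_rel.add) (auto simp: free_SK_def Def)
    then show ?case by simp
  qed
qed

text \<open>Naturally isomorphic operations on objects agree on classes. This allows each operation to be
  replaced by the variant for which compatibility is easiest to check.\<close>

lemma SK_rel_image_iso:
  assumes "u \<in> free_SK D m Z"
    and "\<And>W. W \<in> Def D m Z \<Longrightarrow> F W \<in> Def D m' Z'" "\<And>W. W \<in> Def D m Z \<Longrightarrow> F' W \<in> Def D m' Z'"
    and "\<And>W. W \<in> Def D m Z \<Longrightarrow> isomorphic D (F W) (F' W)"
  shows "(image_mset F u, image_mset F' u) \<in> SK_rel D m' Z'"
  using assms(1)
proof (induction u)
  case empty
  then show ?case by (auto intro: SK_rel.refl simp: free_SK_def)
next
  case (add W u)
  then have "({#F W#}, {#F' W#}) \<in> SK_rel D m' Z'"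
    by (intro SK_rel.iso assms(2-4)) (auto simp: free_SK_def)
  moreover have "(image_mset F u, image_mset F' u) \<in> SK_rel D m' Z'"
    using add by (auto simp: free_SK_def)
  ultimately have "({#F W#} + image_mset F u, {#F' W#} + image_mset F' u) \<in> SK_rel D m' Z'"
    by (rule SK_rel_add)
  then show ?case by simp
qed

lemma respects_SK_iso:
  assumes "respects_SK m Z m' Z' F"
    and "\<And>W. W \<in> Def D m Z \<Longrightarrow> F W \<in> Def D m' Z'" "\<And>W. W \<in> Def D m Z \<Longrightarrow> F' W \<in> Def D m' Z'"
    and "\<And>W. W \<in> Def D m Z \<Longrightarrow> isomorphic D (F W) (F' W)"
  shows "respects_SK m Z m' Z' F'"
  unfolding respects_SK_def
proof (intro allI impI)
  fix u v assume uv: "(u, v) \<in> SK_rel D m Z"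
  then have fr: "u \<in> free_SK D m Z" "v \<in> free_SK D m Z" using SK_rel_free by auto
  note 1 = SK_rel_image_iso[OF fr(1) assms(2-4)] SK_rel_image_iso[OF fr(2) assms(2-4)]
  show "(image_mset F' u, image_mset F' v) \<in> SK_rel D m' Z'"
    using SK_rel.trans[OF SK_rel.sym[OF 1(1)] SK_rel.trans[OF respects_SKD[OF assms(1) uv] 1(2)]] .
qed

text \<open>Additivity on disjoint unions: the scissor relation, with the class of the empty intersection
  removed.\<close>

lemma SK_rel_disjoint:
  assumes "(n, X, f) \<in> Def D m Z" "D n Y" "D n Y'" "X = Y \<union> Y'" "Y \<inter> Y' = {}"
  shows "({#(n, X, f)#}, {#(n, Y, f), (n, Y', f)#}) \<in> SK_rel D m Z"
proof -
  have "(n, {}, f) \<in> Def D m Z" by (rule Def_restrict[OF assms(1)]) (use D_empty assms in auto)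
  then have "({#(n, {}, f)#} + {#(n, X, f)#}, {#} + {#(n, X, f)#}) \<in> SK_rel D m Z"
    by (rule SK_rel.add[OF SK_rel.empty]) (use assms(1) in \<open>simp_all add: free_SK_def\<close>)
  then have "({#(n, X, f)#}, {#(n, X, f), (n, {}, f)#}) \<in> SK_rel D m Z"
    by (intro SK_rel.sym[where u = "{#(n, X, f), (n, {}, f)#}"]) (simp add: add_mset_commute)
  moreover have "({#(n, X, f), (n, {}, f)#}, {#(n, Y, f), (n, Y', f)#}) \<in> SK_rel D m Z"
    using SK_rel.scissor[OF assms(1) assms(2) _ assms(3)] assms(4,5) by simp
  ultimately show ?thesis
    by (rule SK_rel.trans)
qed

lemma span_obj_Def:
  assumes V: "definable_map D d V m Z f" and h: "definable_map D d V m' Z' h"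
    and W: "(k, W, g) \<in> Def D m Z"
  shows "(k + d, fiber_prod W g V f, \<lambda>x. h (drop k x)) \<in> Def D m' Z'"
proof -
  have *: "D k W" "D d V" using W V by (auto simp: Def_def definable_map_def)
  have fp: "D (k + d) (fiber_prod W g V f)"
    by (rule D_fiber_prod) (use W V in \<open>auto simp: mem_Def\<close>)
  have "definable_map D (k + d) (fiber_prod W g V f) d V (drop k)"
    by (rule definable_map_drop) (use fp * D_length in \<open>auto simp: fiber_prod_def\<close>)
  then show ?thesis unfolding mem_Def by (rule definable_map_comp[OF _ h])
qed

lemma respects_span:
  assumes V: "definable_map D d V m Z f" and h: "definable_map D d V m' Z' h"
  shows "respects_SK m Z m' Z' (span_obj V f h d)"
proof (rule respects_SKI[where N = "\<lambda>k. k + d" and G = "\<lambda>k W g. fiber_prod W g V f"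
      and H = "\<lambda>k g x. h (drop k x)"])
  show "span_obj V f h d (n, X, g) = (n + d, fiber_prod X g V f, \<lambda>x. h (drop n x))" for n X g
    by (simp add: span_obj_def)
  show Def: "span_obj V f h d W \<in> Def D m' Z'" if "W \<in> Def D m Z" for W
    using span_obj_Def[OF assms] that by (cases W) (simp add: span_obj_def)
  have DV: "D d V" using V by (simp add: definable_map_def)
  show "isomorphic D (span_obj V f h d W) (span_obj V f h d W')"
    if W: "W \<in> Def D m Z" and W': "W' \<in> Def D m Z" and iso: "isomorphic D W W'" for W W'
  proof -
    obtain n X g n' X' g' where [simp]: "W = (n, X, g)" "W' = (n', X', g')"
      by (metis prod_cases3)
    obtain e k where e: "definable_map D n X n' X' e" "\<forall>x\<in>X. g' (e x) = g x"
      "definable_map D n' X' n X k" "\<forall>x\<in>X'. g (k x) = g' x" "\<forall>x\<in>X. k (e x) = x" "\<forall>x\<in>X'. e (k x) = x"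
      using iso by auto
    have X: "D n X" "D n' X'" using W W' Def_D by auto
    note len = X[THEN D_length] D_length[OF DV]
    have ek: "e x \<in> X'" if "x \<in> X" for x using e(1) that by (auto simp: definable_map_def)
    have ek': "k x \<in> X" if "x \<in> X'" for x using e(3) that by (auto simp: definable_map_def)
    let ?P = "fiber_prod X g V f" and ?P' = "fiber_prod X' g' V f"
    have FW: "(n + d, ?P, \<lambda>x. h (drop n x)) \<in> Def D m' Z'"
      "(n' + d, ?P', \<lambda>x. h (drop n' x)) \<in> Def D m' Z'"
      using W W' span_obj_Def[OF assms] by simp_all
    have "definable_map D (n + d) ?P n X (take n)"
      by (rule definable_map_take) (use FW X Def_D len in \<open>auto simp: fiber_prod_def\<close>)
    then have "definable_map D (n + d) ?P n' X' (\<lambda>x. e (take n x))"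
      by (rule definable_map_comp[OF _ e(1)])
    moreover have "definable_map D (n + d) ?P d V (drop n)"
      by (rule definable_map_drop) (use FW X DV Def_D len in \<open>auto simp: fiber_prod_def\<close>)
    moreover have eP: "e (take n x) @ drop n x \<in> ?P'" "k (take n' (e (take n x) @ drop n x)) @
        drop n' (e (take n x) @ drop n x) = x" if x: "x \<in> ?P" for x
    proof -
      have *: "take n x \<in> X" "drop n x \<in> V" "g (take n x) = f (drop n x)"
        using x len(1) by (auto simp: fiber_prod_def)
      then have **: "g' (e (take n x)) = f (drop n x)" "e (take n x) \<in> X'"
        using e(2) ek by simp_all
      then show "e (take n x) @ drop n x \<in> ?P'" using *(2) unfolding fiber_prod_def by blast
      have "length (e (take n x)) = n'" using **(2) by (rule len(2))
      then show "k (take n' (e (take n x) @ drop n x)) @ drop n' (e (take n x) @ drop n x) = x"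
        using e(5) *(1) by simp
    qed
    moreover have kP: "k (take n' x) @ drop n' x \<in> ?P" "e (take n (k (take n' x) @ drop n' x)) @
        drop n (k (take n' x) @ drop n' x) = x" if x: "x \<in> ?P'" for x
    proof -
      have *: "take n' x \<in> X'" "drop n' x \<in> V" "g' (take n' x) = f (drop n' x)"
        using x len(2) by (auto simp: fiber_prod_def)
      then have **: "g (k (take n' x)) = f (drop n' x)" "k (take n' x) \<in> X"
        using e(4) ek' by simp_all
      then show "k (take n' x) @ drop n' x \<in> ?P" using *(2) unfolding fiber_prod_def by blast
      have "length (k (take n' x)) = n" using **(2) by (rule len(1))
      then show "e (take n (k (take n' x) @ drop n' x)) @ drop n (k (take n' x) @ drop n' x) = x"
        using e(6) *(1) by simp
    qed
    moreover have "h (drop n' (e (take n x) @ drop n x)) = h (drop n x)" if x: "x \<in> ?P" for x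
    proof -
      have "length (e (take n x)) = n'" using x len ek by (auto simp: fiber_prod_def)
      then show ?thesis by simp
    qed
    moreover from calculation have "definable_map D (n + d) ?P (n' + d) ?P' (\<lambda>x. e (take n x) @ drop n x)"
      using Def_D[OF FW(2)] by (intro definable_map_append)
    ultimately have "isomorphic D (n + d, ?P, \<lambda>x. h (drop n x)) (n' + d, ?P', \<lambda>x. h (drop n' x))"
      by (intro isomorphicI[OF FW, where k = "\<lambda>x. k (take n' x) @ drop n' x"])
    then show ?thesis by (simp add: span_obj_def)
  qed
  show "fiber_prod {} g V f = {}" for g by (simp add: fiber_prod_def)
  show "fiber_prod (Y \<union> Y') g V f = fiber_prod Y g V f \<union> fiber_prod Y' g V f" for Y Y' g
    by (auto simp: fiber_prod_def)
  show "fiber_prod (Y \<inter> Y') g V f = fiber_prod Y g V f \<inter> fiber_prod Y' g V f"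
    if "D n Y" "D n Y'" for n Y Y' g
  proof -
    have "x \<in> fiber_prod (Y \<inter> Y') g V f \<longleftrightarrow> x \<in> fiber_prod Y g V f \<inter> fiber_prod Y' g V f" for x
      using mem_fiber_prod[of "Y \<inter> Y'" n x g V f] mem_fiber_prod[of Y n x g V f]
        mem_fiber_prod[of Y' n x g V f] D_length[OF that(1)] D_length[OF that(2)] by blast
    then show ?thesis by blast
  qed
qed

lemma push_Def:
  assumes "definable_map D m Z m' Z' f" "(n, W, g) \<in> Def D m Z"
  shows "(n, W, f \<circ> g) \<in> Def D m' Z'"
  using assms definable_map_comp by (auto simp: mem_Def comp_def)

lemma respects_push:
  assumes "definable_map D m Z m' Z' f"
  shows "respects_SK m Z m' Z' (push_obj f)"
proof (rule respects_SKI[where N = "\<lambda>n. n" and G = "\<lambda>n X g. X" and H = "\<lambda>n g. f \<circ> g"])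
  fix W W' assume "isomorphic D W W'"
  moreover obtain n X g n' X' g' where [simp]: "W = (n, X, g)" "W' = (n', X', g')"
    by (metis prod_cases3)
  ultimately obtain h k where "definable_map D n X n' X' h" "\<forall>x\<in>X. g' (h x) = g x"
    "definable_map D n' X' n X k" "\<forall>x\<in>X'. g (k x) = g' x" "\<forall>x\<in>X. k (h x) = x" "\<forall>x\<in>X'. h (k x) = x"
    by auto
  then show "isomorphic D (push_obj f W) (push_obj f W')"
    unfolding push_obj_def by simp (rule exI[of _ h], simp, rule exI[of _ k], simp)
qed (use push_Def[OF assms] in \<open>auto simp: push_obj_def\<close>)

lemma pull_obj_span: "pull_obj X f n = span_obj X f (\<lambda>x. x) n"
  by (simp add: pull_obj_def span_obj_def fun_eq_iff)

lemma respects_pull: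
  assumes "definable_map D n X m Z f"
  shows "respects_SK m Z n X (pull_obj X f n)"
  unfolding pull_obj_span
  by (rule respects_span[OF assms definable_map_id]) (use assms in \<open>simp add: definable_map_def\<close>)

lemma pull_Def:
  assumes "definable_map D n X m Z f" "(k, W, g) \<in> Def D m Z"
  shows "(k + n, fiber_prod W g X f, drop k) \<in> Def D n X"
  using span_obj_Def[OF assms(1) definable_map_id assms(2)] assms(1)
  by (simp add: definable_map_def)

lemma fiber_obj_Def:
  assumes "(k, W, g) \<in> Def D m Z" "(k', W', g') \<in> Def D m Z"
  shows "(k + k', fiber_prod W g W' g', \<lambda>v. g (take k v)) \<in> Def D m Z"
proof -
  have *: "D k W" "D k' W'" using assms Def_D by auto
  have fp: "D (k + k') (fiber_prod W g W' g')"
    by (rule D_fiber_prod) (use assms in \<open>auto simp: mem_Def\<close>)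
  have "definable_map D (k + k') (fiber_prod W g W' g') k W (take k)"
    by (rule definable_map_take) (use fp * D_length in \<open>auto simp: fiber_prod_def\<close>)
  then show ?thesis using assms unfolding mem_Def by (blast intro: definable_map_comp)
qed

lemma fiber_obj_Def': "V \<in> Def D m Z \<Longrightarrow> W \<in> Def D m Z \<Longrightarrow> fiber_obj V W \<in> Def D m Z"
  by (cases V; cases W) (simp add: fiber_obj_Def)

text \<open>A fiber product with \<open>W \<rightarrow> Z\<close> fixed is pull-push along the span \<open>Z \<leftarrow> W \<rightarrow> Z\<close>; the structure maps
  differ as functions but agree on the fiber product.\<close>

lemma respects_fiber_left:
  assumes "W \<in> Def D m Z"
  shows "respects_SK m Z m Z (\<lambda>V. fiber_obj V W)"
proof -
  obtain k' W' g' where [simp]: "W = (k', W', g')" by (metis prod_cases3)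
  have W: "definable_map D k' W' m Z g'" using assms by (simp add: mem_Def)
  show ?thesis
  proof (rule respects_SK_iso[OF respects_span[OF W W]])
    fix V assume V: "V \<in> Def D m Z"
    obtain k U g where [simp]: "V = (k, U, g)" by (metis prod_cases3)
    have len: "\<And>x. x \<in> U \<Longrightarrow> length x = k" using V Def_length by simp
    show 1: "span_obj W' g' g' k' V \<in> Def D m Z"
      using span_obj_Def[OF W W] V by (simp add: span_obj_def)
    show "fiber_obj V W \<in> Def D m Z" using fiber_obj_Def' V assms by blast
    have 2: "(k + k', fiber_prod U g W' g', \<lambda>x. g' (drop k x)) \<in> Def D m Z"
      using 1 by (simp add: span_obj_def)
    have "isomorphic D (k + k', fiber_prod U g W' g', \<lambda>x. g' (drop k x))
        (k + k', fiber_prod U g W' g', \<lambda>v. g (take k v))"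
      by (rule isomorphic_cong[OF 2]) (auto simp: fiber_prod_def len)
    then show "isomorphic D (span_obj W' g' g' k' V) (fiber_obj V W)"
      by (simp add: span_obj_def)
  qed
qed

lemma fiber_obj_commute:
  assumes "V \<in> Def D m Z" "W \<in> Def D m Z"
  shows "isomorphic D (fiber_obj V W) (fiber_obj W V)"
proof -
  obtain k U g where [simp]: "V = (k, U, g)" by (metis prod_cases3)
  obtain k' W' g' where [simp]: "W = (k', W', g')" by (metis prod_cases3)
  have len: "\<And>x. x \<in> U \<Longrightarrow> length x = k" "\<And>x. x \<in> W' \<Longrightarrow> length x = k'"
    using assms Def_length by simp_all
  have F: "(k + k', fiber_prod U g W' g', \<lambda>v. g (take k v)) \<in> Def D m Z"
    "(k' + k, fiber_prod W' g' U g, \<lambda>v. g' (take k' v)) \<in> Def D m Z"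
    using fiber_obj_Def assms by auto
  have "coord (k + k') (k' + k) (\<lambda>x. drop k x @ take k x)"
    by (rule coord_intros | simp)+
  then have "isomorphic D (k + k', fiber_prod U g W' g', \<lambda>v. g (take k v))
      (k' + k, fiber_prod W' g' U g, \<lambda>v. g' (take k' v))"
    by (rule isomorphic_coordI[OF F, where k = "\<lambda>x. drop k' x @ take k' x"])
      (auto simp: len elim!: fiber_prodE intro!: fiber_prodI)
  then show ?thesis by simp
qed

lemma respects_fiber_right:
  assumes "V \<in> Def D m Z"
  shows "respects_SK m Z m Z (fiber_obj V)"
  by (rule respects_SK_iso[OF respects_fiber_left[OF assms]])
    (use assms fiber_obj_Def' fiber_obj_commute in blast)+

lemma mult_free_add_right: "mult_free u (add_mset W v) = image_mset (\<lambda>V. fiber_obj V W) u + mult_free u v"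
  by (induction u) (simp_all add: mult_free_def)

lemma mult_free_add_left: "mult_free (add_mset V u) v = image_mset (fiber_obj V) v + mult_free u v"
  by (simp add: mult_free_def)

lemma mult_free_empty: "mult_free {#} v = {#}" "mult_free u {#} = {#}"
  by (induction u) (simp_all add: mult_free_def)

lemma mult_free_cong_left:
  assumes "(u, u') \<in> SK_rel D m Z" "v \<in> free_SK D m Z"
  shows "(mult_free u v, mult_free u' v) \<in> SK_rel D m Z"
  using assms(2)
proof (induction v)
  case empty
  then show ?case by (auto simp: mult_free_empty free_SK_def intro: SK_rel.refl)
next
  case (add W v)
  then have "W \<in> Def D m Z" "v \<in> free_SK D m Z" by (auto simp: free_SK_def)
  then show ?case unfolding mult_free_add_right
    using add.IH by (intro SK_rel_add respects_SKD[OF respects_fiber_left assms(1)]) auto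
qed

lemma mult_free_cong_right:
  assumes "(v, v') \<in> SK_rel D m Z" "u \<in> free_SK D m Z"
  shows "(mult_free u v, mult_free u v') \<in> SK_rel D m Z"
  using assms(2)
proof (induction u)
  case empty
  then show ?case by (auto simp: mult_free_empty free_SK_def intro: SK_rel.refl)
next
  case (add V u)
  then have "V \<in> Def D m Z" "u \<in> free_SK D m Z" by (auto simp: free_SK_def)
  then show ?case unfolding mult_free_add_left
    using add.IH by (intro SK_rel_add respects_SKD[OF respects_fiber_right assms(1)]) auto
qed

lemma SK_mult_class:
  assumes "u \<in> free_SK D m Z" "v \<in> free_SK D m Z"
  shows "SK_rel D m Z `` {u} \<otimes>\<^bsub>SK0 D m Z\<^esub> SK_rel D m Z `` {v} = SK_rel D m Z `` {mult_free u v}"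
proof -
  have "(\<Union>v'\<in>SK_rel D m Z `` {v}. SK_rel D m Z `` {mult_free u' v'}) = SK_rel D m Z `` {mult_free u' v}"
    if "u' \<in> free_SK D m Z" for u'
    by (rule Union_class[OF assms(2) SK_rel_class_eq[OF mult_free_cong_right[OF SK_rel.sym that]]])
  then have "(\<Union>u'\<in>SK_rel D m Z `` {u}. \<Union>v'\<in>SK_rel D m Z `` {v}. SK_rel D m Z `` {mult_free u' v'}) =
      (\<Union>u'\<in>SK_rel D m Z `` {u}. SK_rel D m Z `` {mult_free u' v})"
    using SK_rel_free by (intro SUP_cong) auto
  also have "\<dots> = SK_rel D m Z `` {mult_free u v}"
    by (rule Union_class[OF assms(1) SK_rel_class_eq[OF mult_free_cong_left[OF SK_rel.sym assms(2)]]])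
  finally show ?thesis by (simp add: SK0_def)
qed

lemma respects_SK_cong:
  assumes "respects_SK m Z m' Z' F" "\<And>W. W \<in> Def D m Z \<Longrightarrow> F' W = F W"
  shows "respects_SK m Z m' Z' F'"
proof -
  have "image_mset F' u = image_mset F u" if "u \<in> free_SK D m Z" for u
    by (rule image_mset_cong) (use that assms(2) in \<open>auto simp: free_SK_def\<close>)
  then show ?thesis
    using assms(1) SK_rel_free unfolding respects_SK_def by (metis (no_types, lifting))
qed

text \<open>Over a one-point base the fiber product with \<open>U\<close> is the cartesian product, so base change from
  the point is pull-push along the span from the point to \<open>U\<close>.\<close>

lemma view_over_class:
  assumes "D l {c}" "D m U" "(k, W, g) \<in> Def D l {c}"
  shows "view_over D m U (SK_class D l {c} (k, W, g)) = SK_class D m U (k + m, cprod W U, drop k)"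
proof -
  let ?F = "\<lambda>(k, W, g :: 'm list \<Rightarrow> 'm list). (k + m, cprod W U, drop k)"
  have "respects_SK l {c} m U ?F"
  proof (rule respects_SK_cong[OF respects_span[OF definable_map_const definable_map_id]])
    fix V assume V: "V \<in> Def D l {c}"
    obtain k W g where [simp]: "V = (k, W, g)" by (metis prod_cases3)
    have "fiber_prod W g U (\<lambda>_. c) = cprod W U"
      using V Def_Pi[of k W g l "{c}"]
      by (auto elim!: fiber_prodE cprodE intro!: fiber_prodI cprodI)
    then show "?F V = span_obj U (\<lambda>_. c) (\<lambda>x. x) m V"
      by (simp add: span_obj_def fun_eq_iff)
  qed (use assms in auto)
  then have "SK_induced D m U ?F (SK_rel D l {c} `` {{#(k, W, g)#}}) =
      SK_rel D m U `` {image_mset ?F {#(k, W, g)#}}"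
    by (intro SK_induced_class) (use assms(3) in \<open>auto simp: free_SK_def\<close>)
  then show ?thesis by (simp add: view_over_def SK_class_def)
qed

lemma cprod_Def:
  assumes "D k W" "definable_map D d V m Z h"
  shows "(k + d, cprod W V, \<lambda>x. h (drop k x)) \<in> Def D m Z"
proof -
  have V: "D d V" using assms(2) by (simp add: definable_map_def)
  have "definable_map D (k + d) (cprod W V) d V (drop k)"
    by (rule definable_map_drop) (use D_cprod V assms(1) D_length in \<open>auto simp: cprod_def\<close>)
  then show ?thesis unfolding mem_Def by (rule definable_map_comp[OF _ assms(2)])
qed

lemma view_Def: "D k W \<Longrightarrow> D m U \<Longrightarrow> (k + m, cprod W U, drop k) \<in> Def D m U"
  using cprod_Def[OF _ definable_map_id] by simp

text \<open>A constant family \<open>W \<times> U\<close> pulls back to the constant family \<open>W \<times> V\<close>.\<close>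

lemma span_view_SK:
  assumes f: "definable_map D d V m U f" and h: "definable_map D d V m' Z' h" and W: "D k W"
  shows "({#span_obj V f h d (k + m, cprod W U, drop k)#}, {#(k + d, cprod W V, \<lambda>x. h (drop k x))#})
    \<in> SK_rel D m' Z'"
proof -
  have *: "D d V" "D m U" "\<And>v. v \<in> V \<Longrightarrow> f v \<in> U" using f by (auto simp: definable_map_def)
  note len = D_length[OF W] *(1,2)[THEN D_length]
  note 1 = span_obj_Def[OF f h view_Def[OF W *(2)]] and 2 = cprod_Def[OF W h]
  have "coord (k + m + d) (k + d) (\<lambda>x. take k x @ drop (k + m) x)"
    by (rule coord_intros | simp)+
  then have "isomorphic D (k + m + d, fiber_prod (cprod W U) (drop k) V f, \<lambda>x. h (drop (k + m) x))
    (k + d, cprod W V, \<lambda>x. h (drop k x))"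
  proof (rule isomorphic_coordI[OF 1 2, where k = "\<lambda>y. (take k y @ f (drop k y)) @ drop k y"])
    fix x assume "x \<in> cprod W V"
    then obtain w v where "x = w @ v" "w \<in> W" "v \<in> V" by (rule cprodE)
    then show "(take k x @ f (drop k x)) @ drop k x \<in> fiber_prod (cprod W U) (drop k) V f"
      using * len by (intro fiber_prodI cprodI) auto
  qed (auto simp: len * elim!: fiber_prodE cprodE intro!: cprodI)
  then show ?thesis unfolding span_obj_def using SK_rel.iso[OF 1 2] by simp
qed

section \<open>Kernels over the square of the base\<close>

context
  fixes a n :: nat and Z :: "'m list set" and p :: "'m list \<Rightarrow> 'm list"
begin

text \<open>The set \<open>Z \<times>\<^sub>X U\<close>, for \<open>U \<subseteq> X \<times> X\<close> projected to its first factor.\<close>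

definition kernel_apex :: "'m list set \<Rightarrow> 'm list set" where
  "kernel_apex U = fiber_prod Z p U (take a)"

definition kernel_span :: "'m list set \<Rightarrow> 'm dobj \<Rightarrow> 'm dobj" where
  "kernel_span U = span_obj (kernel_apex U) (drop n) (drop (n + a)) (n + (a + a))"

text \<open>The action of a kernel \<open>g : W \<rightarrow> U \<subseteq> X \<times> X\<close> on \<open>Z \<rightarrow> X\<close>, in the form in which the composite of two Radon
  transforms produces it. The form \<open>kernel_span\<close> carries an additional copy of the point
  of \<open>U\<close>, but is visibly compatible with the relations.\<close>

definition kernel_image :: "nat \<Rightarrow> 'm list set \<Rightarrow> ('m list \<Rightarrow> 'm list) \<Rightarrow> 'm dobj" where
  "kernel_image k W g =
     (n + k, fiber_prod Z p W (\<lambda>w. take a (g w)), \<lambda>x. drop a (g (drop n x)))"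

context
  fixes X :: "'m list set"
  assumes X: "D a X" and Z: "(n, Z, p) \<in> Def D a X"
begin

lemma square_maps:
  assumes "D (a + a) U" "U \<subseteq> cprod X X"
  shows "definable_map D (a + a) U a X (take a)" "definable_map D (a + a) U a X (drop a)"
  by (rule definable_map_take definable_map_drop;
      use assms X D_length[OF X] in \<open>fastforce elim!: cprodE\<close>)+

lemma kernel_apex_maps:
  assumes "D (a + a) U" "U \<subseteq> cprod X X"
  shows "definable_map D (n + (a + a)) (kernel_apex U) (a + a) U (drop n)"
    and "definable_map D (n + (a + a)) (kernel_apex U) a X (drop (n + a))"
proof -
  have len: "\<And>z. z \<in> Z \<Longrightarrow> length z = n" using Z Def_length by blast
  have "D (n + (a + a)) (kernel_apex U)"
    unfolding kernel_apex_def using D_fiber_prod Z square_maps(1)[OF assms] mem_Def by blast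
  then show 1: "definable_map D (n + (a + a)) (kernel_apex U) (a + a) U (drop n)"
    by (rule definable_map_drop) (use assms len in \<open>auto simp: kernel_apex_def fiber_prod_def\<close>)
  show "definable_map D (n + (a + a)) (kernel_apex U) a X (drop (n + a))"
    using definable_map_comp[OF 1 square_maps(2)[OF assms]] by (simp add: add.commute)
qed

lemma kernel_image_Def:
  assumes U: "D (a + a) U" "U \<subseteq> cprod X X" and W: "(k, W, g) \<in> Def D (a + a) U"
  shows "kernel_image k W g \<in> Def D a X"
proof -
  have len: "\<And>z. z \<in> Z \<Longrightarrow> length z = n" using Z Def_length by blast
  have g: "definable_map D k W (a + a) U g" using W by (simp add: mem_Def)
  have "D (n + k) (fiber_prod Z p W (\<lambda>w. take a (g w)))"
    using D_fiber_prod Z definable_map_comp[OF g square_maps(1)[OF U]] mem_Def by blast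
  then have "definable_map D (n + k) (fiber_prod Z p W (\<lambda>w. take a (g w))) k W (drop n)"
    by (rule definable_map_drop) (use Def_D[OF W] len in \<open>auto simp: fiber_prod_def\<close>)
  then show ?thesis unfolding kernel_image_def mem_Def
    by (rule definable_map_comp[OF _ definable_map_comp[OF g square_maps(2)[OF U]]])
qed

lemma kernel_span_SK:
  assumes U: "D (a + a) U" "U \<subseteq> cprod X X" and W: "(k, W, g) \<in> Def D (a + a) U"
  shows "({#kernel_span U (k, W, g)#}, {#kernel_image k W g#}) \<in> SK_rel D a X"
proof -
  have len: "\<And>z. z \<in> Z \<Longrightarrow> length z = n" "\<And>w. w \<in> W \<Longrightarrow> length w = k"
    "\<And>u. u \<in> U \<Longrightarrow> length u = a + a"
    using Z W Def_length U D_length by blast+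
  have gU: "g w \<in> U" if "w \<in> W" for w using Def_Pi[OF W that] .
  note 1 = span_obj_Def[OF kernel_apex_maps[OF U] W] and 2 = kernel_image_Def[OF U W]
  have "coord (k + (n + (a + a))) (n + k) (\<lambda>x. take n (drop k x) @ take k x)"
    by (rule coord_intros | simp)+
  then have "isomorphic D (k + (n + (a + a)), fiber_prod W g (kernel_apex U) (drop n), \<lambda>x. drop (n + a) (drop k x))
    (kernel_image k W g)"
    unfolding kernel_image_def
  proof (rule isomorphic_coordI[OF 1 2[unfolded kernel_image_def],
        where k = "\<lambda>y. drop n y @ (take n y @ g (drop n y))"])
    fix x assume "x \<in> fiber_prod W g (kernel_apex U) (drop n)"
    then obtain w z u where x: "x = w @ z @ u" "w \<in> W" "z \<in> Z" "u \<in> U" "g w = u" "p z = take a u"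
      by (auto simp: kernel_apex_def len elim!: fiber_prodE)
    show "take n (drop k x) @ take k x \<in> fiber_prod Z p W (\<lambda>w. take a (g w))"
      using x by (intro fiber_prodI) (auto simp: len)
    show "drop n (take n (drop k x) @ take k x) @ take n (take n (drop k x) @ take k x) @
        g (drop n (take n (drop k x) @ take k x)) = x"
      using x by (simp add: len)
    show "drop a (g (drop n (take n (drop k x) @ take k x))) = drop (n + a) (drop k x)"
      using x by (simp add: len)
  next
    fix y assume "y \<in> fiber_prod Z p W (\<lambda>w. take a (g w))"
    then obtain z w where y: "y = z @ w" "z \<in> Z" "w \<in> W" "p z = take a (g w)" by (rule fiber_prodE)
    show "drop n y @ (take n y @ g (drop n y)) \<in> fiber_prod W g (kernel_apex U) (drop n)"
      unfolding kernel_apex_def using y by (intro fiber_prodI) (auto simp: len gU)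
    show "take n (drop k (drop n y @ (take n y @ g (drop n y)))) @
        take k (drop n y @ (take n y @ g (drop n y))) = y"
      using y by (simp add: len)
  qed
  then show ?thesis using 1 2 by (intro SK_rel.iso) (simp_all add: kernel_span_def span_obj_def)
qed

lemma respects_kernel_span:
  assumes "D (a + a) U" "U \<subseteq> cprod X X"
  shows "respects_SK (a + a) U a X (kernel_span U)"
  unfolding kernel_span_def by (rule respects_span[OF kernel_apex_maps[OF assms]])

lemma kernel_span_view_SK:
  assumes "D (a + a) U" "U \<subseteq> cprod X X" "D k W"
  shows "({#kernel_span U (k + (a + a), cprod W U, drop k)#},
    {#(k + (n + (a + a)), cprod W (kernel_apex U), \<lambda>x. drop (n + a) (drop k x))#}) \<in> SK_rel D a X"
  unfolding kernel_span_def by (rule span_view_SK[OF kernel_apex_maps[OF assms(1,2)] assms(3)])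

lemma D_square: "D (a + a) (cprod X X)"
  by (rule D_cprod[OF X X])

lemma D_diagonal: "D (a + a) (diagonal X)"
  unfolding diagonal_def by (rule D_graph_coord[OF X coord_id])

lemma diagonal_subset: "diagonal X \<subseteq> cprod X X"
  by (auto simp: diagonal_def cprod_def)

text \<open>A point of \<open>Z \<times>\<^sub>X (X \<times> X)\<close> is a point \<open>z\<close> of \<open>Z\<close> and a point \<open>x'\<close> of \<open>X\<close>, the middle coordinate being
  \<open>p z\<close>. The map that forgets \<open>p z\<close> and doubles \<open>x'\<close> is a coordinate map; its inverse is not, as it
  has to compute \<open>p z\<close>.\<close>

lemma square_view_SK:
  assumes W: "D k W"
  shows "({#(k + (n + (a + a)), cprod W (kernel_apex (cprod X X)), \<lambda>x. drop (n + a) (drop k x))#},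
    {#fiber_obj (k + a, cprod W X, drop k) (n + a, cprod Z X, drop n)#}) \<in> SK_rel D a X"
proof -
  have len: "\<And>z. z \<in> Z \<Longrightarrow> length z = n" "\<And>w. w \<in> W \<Longrightarrow> length w = k" "\<And>x. x \<in> X \<Longrightarrow> length x = a"
    using Z Def_length W X D_length by blast+
  have pX: "p z \<in> X" if "z \<in> Z" for z using Def_Pi[OF Z that] .
  note 1 = cprod_Def[OF W kernel_apex_maps(2)[OF D_square subset_refl]]
    and 2 = fiber_obj_Def[OF view_Def[OF W X] view_Def[OF Def_D[OF Z] X]]
  have "coord (k + (n + (a + a))) (k + a + (n + a))
      (\<lambda>x. (take k x @ drop (k + (n + a)) x) @ (take n (drop k x) @ drop (k + (n + a)) x))"
    by (rule coord_intros | simp)+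
  then have "isomorphic D (k + (n + (a + a)), cprod W (kernel_apex (cprod X X)), \<lambda>x. drop (n + a) (drop k x))
     (k + a + (n + a), fiber_prod (cprod W X) (drop k) (cprod Z X) (drop n), \<lambda>v. drop k (take (k + a) v))"
  proof (rule isomorphic_coordI[OF 1 2, where k = "\<lambda>y. take k y @ (take n (drop (k + a) y) @
          (p (take n (drop (k + a) y)) @ drop (k + a + n) y))"])
    fix x assume "x \<in> cprod W (kernel_apex (cprod X X))"
    then obtain w z x' where x: "x = w @ z @ p z @ x'" "w \<in> W" "z \<in> Z" "x' \<in> X"
      by (auto simp: kernel_apex_def len elim!: fiber_prodE cprodE)
    let ?h = "(take k x @ drop (k + (n + a)) x) @ (take n (drop k x) @ drop (k + (n + a)) x)"
    have h: "?h = (w @ x') @ (z @ x')" using x by (simp add: len pX)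
    show "?h \<in> fiber_prod (cprod W X) (drop k) (cprod Z X) (drop n)"
      unfolding h using x by (intro fiber_prodI cprodI) (auto simp: len)
    show "take k ?h @ (take n (drop (k + a) ?h) @ (p (take n (drop (k + a) ?h)) @ drop (k + a + n) ?h)) = x"
      unfolding h using x by (simp add: len)
    show "drop k (take (k + a) ?h) = drop (n + a) (drop k x)"
      unfolding h using x by (simp add: len pX)
  next
    fix y assume "y \<in> fiber_prod (cprod W X) (drop k) (cprod Z X) (drop n)"
    then obtain w z x where y: "y = w @ x @ z @ x" "w \<in> W" "z \<in> Z" "x \<in> X"
      by (auto simp: len elim!: fiber_prodE cprodE)
    let ?k = "take k y @ (take n (drop (k + a) y) @ (p (take n (drop (k + a) y)) @ drop (k + a + n) y))"
    have k: "?k = w @ (z @ (p z @ x))" using y by (simp add: len)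
    show "?k \<in> cprod W (kernel_apex (cprod X X))"
      unfolding k kernel_apex_def using y by (intro cprodI fiber_prodI) (auto simp: len pX)
    show "(take k ?k @ drop (k + (n + a)) ?k) @ (take n (drop k ?k) @ drop (k + (n + a)) ?k) = y"
      unfolding k using y by (simp add: len pX)
  qed
  then show ?thesis using 1 2 by (intro SK_rel.iso) simp_all
qed

text \<open>A point of \<open>Z \<times>\<^sub>X \<Delta>\<close> has the form \<open>(z, p z, p z)\<close>, so \<open>Z \<times>\<^sub>X \<Delta>\<close> is \<open>Z\<close> over \<open>X\<close>.\<close>

lemma diagonal_view_SK:
  assumes W: "D k W"
  shows "({#(k + (n + (a + a)), cprod W (kernel_apex (diagonal X)), \<lambda>x. drop (n + a) (drop k x))#},
    {#fiber_obj (k + a, cprod W X, drop k) (n, Z, p)#}) \<in> SK_rel D a X"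
proof -
  have len: "\<And>z. z \<in> Z \<Longrightarrow> length z = n" "\<And>w. w \<in> W \<Longrightarrow> length w = k" "\<And>x. x \<in> X \<Longrightarrow> length x = a"
    using Z Def_length W X D_length by blast+
  have pX: "p z \<in> X" if "z \<in> Z" for z using Def_Pi[OF Z that] .
  note 1 = cprod_Def[OF W kernel_apex_maps(2)[OF D_diagonal diagonal_subset]]
    and 2 = fiber_obj_Def[OF view_Def[OF W X] Z]
  have "coord (k + (n + (a + a))) (k + a + n)
      (\<lambda>x. (take k x @ drop (k + (n + a)) x) @ take n (drop k x))"
    by (rule coord_intros | simp)+
  then have "isomorphic D (k + (n + (a + a)), cprod W (kernel_apex (diagonal X)), \<lambda>x. drop (n + a) (drop k x))
     (k + a + n, fiber_prod (cprod W X) (drop k) Z p, \<lambda>v. drop k (take (k + a) v))"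
  proof (rule isomorphic_coordI[OF 1 2, where k = "\<lambda>y. take k y @ (drop (k + a) y @
          (take a (drop k y) @ take a (drop k y)))"])
    fix x assume "x \<in> cprod W (kernel_apex (diagonal X))"
    then obtain w z where x: "x = w @ z @ p z @ p z" "w \<in> W" "z \<in> Z"
      by (auto simp: kernel_apex_def diagonal_def len elim!: fiber_prodE cprodE)
    let ?h = "(take k x @ drop (k + (n + a)) x) @ take n (drop k x)"
    have h: "?h = (w @ p z) @ z" using x by (simp add: len pX)
    show "?h \<in> fiber_prod (cprod W X) (drop k) Z p"
      unfolding h using x by (intro fiber_prodI cprodI) (auto simp: len pX)
    show "take k ?h @ (drop (k + a) ?h @ (take a (drop k ?h) @ take a (drop k ?h))) = x"
      unfolding h using x by (simp add: len pX)
    show "drop k (take (k + a) ?h) = drop (n + a) (drop k x)"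
      unfolding h using x by (simp add: len pX)
  next
    fix y assume "y \<in> fiber_prod (cprod W X) (drop k) Z p"
    then obtain w z where y: "y = w @ p z @ z" "w \<in> W" "z \<in> Z"
      by (auto simp: len elim!: fiber_prodE cprodE)
    let ?k = "take k y @ (drop (k + a) y @ (take a (drop k y) @ take a (drop k y)))"
    have k: "?k = w @ (z @ (p z @ p z))" using y by (simp add: len pX)
    have "p z @ p z \<in> diagonal X" using pX[OF y(3)] by (auto simp: diagonal_def)
    then show "?k \<in> cprod W (kernel_apex (diagonal X))"
      unfolding k kernel_apex_def using y by (intro cprodI fiber_prodI) (auto simp: len pX)
    show "(take k ?k @ drop (k + (n + a)) ?k) @ take n (drop k ?k) = y"
      unfolding k using y by (simp add: len pX)
  qed
  then show ?thesis using 1 2 by (intro SK_rel.iso) simp_all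
qed

end

end

section \<open>Inversion\<close>

lemma SK_class_eqD:
  "SK_class D m Z V = SK_rel D m Z `` {u} \<Longrightarrow> V \<in> Def D m Z \<Longrightarrow> ({#V#}, u) \<in> SK_rel D m Z"
  using SK_rel_class_eqD[of m Z u "{#V#}"] SK_rel.sym by (auto simp: SK_class_def free_SK_def)

lemma radon_class:
  assumes X: "D a X" and Y: "D b Y" and S: "D (a + b) S" "S \<subseteq> cprod X Y"
    and Z: "(n, Z, p) \<in> Def D a X"
  shows "radon D a b Y S (SK_class D a X (n, Z, p)) =
      SK_class D b Y (n + (a + b), fiber_prod Z p S (take a), drop a \<circ> drop n)"
    and "(n + (a + b), fiber_prod Z p S (take a), drop a \<circ> drop n) \<in> Def D b Y"
proof -
  have "definable_map D (a + b) S a X (take a)" and "definable_map D (a + b) S b Y (drop a)"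
    by (rule definable_map_take definable_map_drop;
        use S X Y D_length[OF X] in \<open>fastforce elim!: cprodE\<close>)+
  note q = this
  note P = pull_Def[OF q(1) Z]
  show "(n + (a + b), fiber_prod Z p S (take a), drop a \<circ> drop n) \<in> Def D b Y"
    by (rule push_Def[OF q(2) P])
  have "radon D a b Y S (SK_class D a X (n, Z, p)) =
      push D b Y (drop a) (SK_rel D (a + b) S `` {image_mset (pull_obj S (take a) (a + b)) {#(n, Z, p)#}})"
    using SK_induced_class[OF _ respects_pull[OF q(1)], of "{#(n, Z, p)#}"] Z
    by (simp add: radon_def pull_def SK_class_def free_SK_def)
  also have "\<dots> = push D b Y (drop a)
      (SK_rel D (a + b) S `` {{#(n + (a + b), fiber_prod Z p S (take a), drop n)#}})"
    by (simp add: pull_obj_def)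
  also have "\<dots> = SK_rel D b Y ``
      {image_mset (push_obj (drop a)) {#(n + (a + b), fiber_prod Z p S (take a), drop n)#}}"
    unfolding push_def
    by (rule SK_induced_class[OF _ respects_push[OF q(2)]]) (use P in \<open>simp add: free_SK_def\<close>)
  finally show "radon D a b Y S (SK_class D a X (n, Z, p)) =
      SK_class D b Y (n + (a + b), fiber_prod Z p S (take a), drop a \<circ> drop n)"
    by (simp add: SK_class_def push_obj_def)
qed

lemma radon_inversion:
  fixes n :: nat and r :: "'m list \<Rightarrow> 'm list"
  assumes X: "D a X" and Y: "D b Y"
    and S: "D (a + b) S" "S \<subseteq> cprod X Y" and S': "D (b + a) S'" "S' \<subseteq> cprod Y X"
    and c: "D l {c}"
    and SS: "SS = fiber_prod S (drop a) S' (take b)"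
    and r: "r = (\<lambda>w. take a w @ drop (a + b + b) w)"
    and B1: "B1 = SS - r -` diagonal X" and B2: "B2 = SS \<inter> r -` diagonal X"
    and Z1: "Z1 \<in> Def D l {c}" and Z2: "Z2 \<in> Def D l {c}"
    and star: "SK_class D (a + a) (cprod X X - diagonal X) (a + b + (b + a), B1, r) =
      view_over D (a + a) (cprod X X - diagonal X) (SK_class D l {c} Z1)"
    and star_star: "SK_class D (a + a) (diagonal X) (a + b + (b + a), B2, r) =
      view_over D (a + a) (diagonal X) (SK_class D l {c} Z1)
        \<oplus>\<^bsub>SK0 D (a + a) (diagonal X)\<^esub> view_over D (a + a) (diagonal X) (SK_class D l {c} Z2)"
    and Z: "(n, Z, p) \<in> Def D a X"
  shows "radon D b a X S' (radon D a b Y S (SK_class D a X (n, Z, p))) =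
    (view_over D a X (SK_class D l {c} Z2) \<otimes>\<^bsub>SK0 D a X\<^esub> SK_class D a X (n, Z, p))
      \<oplus>\<^bsub>SK0 D a X\<^esub>
    (view_over D a X (SK_class D l {c} Z1) \<otimes>\<^bsub>SK0 D a X\<^esub>
      view_over D a X (SK_class D l {c} (n, Z, \<lambda>_. c)))"
proof -
  obtain k1 W1 g1 where Z1_eq: "Z1 = (k1, W1, g1)" by (metis prod_cases3)
  obtain k2 W2 g2 where Z2_eq: "Z2 = (k2, W2, g2)" by (metis prod_cases3)
  have W1: "D k1 W1" and W2: "D k2 W2" using Z1 Z2 Def_D unfolding Z1_eq Z2_eq by blast+
  let ?\<Delta> = "diagonal X" and ?K = "a + b + (b + a)"
  let ?XX = "cprod X X"
  let ?X1 = "?XX - ?\<Delta>"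
  let ?E = "\<lambda>W. kernel_image a n Z p ?K W r"
  let ?V = "\<lambda>k W U. (k + (a + a), cprod W U, drop k)"
  let ?T = "kernel_span a n Z p"
  let ?view1 = "(k1 + a, cprod W1 X, drop k1)" and ?view2 = "(k2 + a, cprod W2 X, drop k2)"
    and ?viewZ = "(n + a, cprod Z X, drop n)"
  let ?H = "\<lambda>k W U. (k + (n + (a + a)), cprod W (kernel_apex a Z p U), \<lambda>x. drop (n + a) (drop k x))"
  have XX: "D (a + a) ?XX" and \<Delta>: "D (a + a) ?\<Delta>" and X1: "D (a + a) ?X1"
    using D_square[OF X Z] D_diagonal[OF X Z] D_Diff by blast+
  have sub: "?XX \<subseteq> ?XX" "?\<Delta> \<subseteq> ?XX" "?X1 \<subseteq> ?XX" using diagonal_subset[OF X Z] by blast+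
  have len: "\<And>x. x \<in> X \<Longrightarrow> length x = a" "\<And>y. y \<in> Y \<Longrightarrow> length y = b"
    "\<And>z. z \<in> Z \<Longrightarrow> length z = n"
    using X Y Z D_length Def_length by blast+
  have lenS: "\<And>s. s \<in> S \<Longrightarrow> length s = a + b" "\<And>s. s \<in> S' \<Longrightarrow> length s = b + a"
    using S S' D_length by blast+

  have "definable_map D (a + b) S b Y (drop a)" "definable_map D (b + a) S' b Y (take b)"
    by (rule definable_map_take definable_map_drop;
        use S S' Y len in \<open>fastforce elim!: cprodE\<close>)+
  then have DSS: "D ?K SS" unfolding SS by (rule D_fiber_prod)
  have r_coord: "coord ?K (a + a) r" unfolding r by (rule coord_intros | simp)+
  have rX: "r w \<in> ?XX" "take a (r w) = take a w" "drop a (r w) = drop (a + b + b) w" if w: "w \<in> SS" for w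
  proof -
    obtain s s' where s: "w = s @ s'" "s \<in> S" "s' \<in> S'" using w unfolding SS by (rule fiber_prodE)
    obtain x y where x: "s = x @ y" "x \<in> X" "y \<in> Y" using S(2) s(2) by (blast elim: cprodE)
    obtain y' x' where x': "s' = y' @ x'" "y' \<in> Y" "x' \<in> X" using S'(2) s(3) by (blast elim: cprodE)
    have "r w = x @ x'" unfolding r s(1) x(1) x'(1) using x x' by (simp add: len)
    then show "r w \<in> ?XX" "take a (r w) = take a w" "drop a (r w) = drop (a + b + b) w"
      using x x' s(1) by (auto simp: len intro!: cprodI)
  qed
  have SS_Def: "(?K, SS, r) \<in> Def D (a + a) ?XX"
    unfolding mem_Def by (rule definable_map_coord[OF DSS XX r_coord]) (use rX in auto)
  have "D ?K (SS \<inter> {w. length w = ?K \<and> r w \<in> ?\<Delta>})"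
    by (intro D_Int DSS D_vimage_coord[OF \<Delta> r_coord])
  also have "SS \<inter> {w. length w = ?K \<and> r w \<in> ?\<Delta>} = B2"
    using D_length[OF DSS] unfolding B2 by blast
  finally have DB2: "D ?K B2" .
  have "B1 = SS - B2" unfolding B1 B2 by blast
  then have DB1: "D ?K B1" using D_Diff DSS DB2 by simp
  have B1_Def: "(?K, B1, r) \<in> Def D (a + a) ?X1"
    unfolding mem_Def by (rule definable_map_coord[OF DB1 X1 r_coord]) (use rX in \<open>auto simp: B1\<close>)
  have B2_Def: "(?K, B2, r) \<in> Def D (a + a) ?\<Delta>"
    unfolding mem_Def by (rule definable_map_coord[OF DB2 \<Delta> r_coord]) (auto simp: B2)

  let ?O = "(n + (a + b) + (b + a), fiber_prod (fiber_prod Z p S (take a)) (drop a \<circ> drop n) S' (take b),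
      drop b \<circ> drop (n + (a + b)))"
  note R1 = radon_class[OF X Y S Z]
  note R2 = radon_class[OF Y X S' R1(2)]
  have E_Def: "?E SS \<in> Def D a X" by (rule kernel_image_Def[OF X Z XX sub(1) SS_Def])
  have E_B1: "?E B1 \<in> Def D a X" by (rule kernel_image_Def[OF X Z X1 sub(3) B1_Def])
  have E_B2: "?E B2 \<in> Def D a X" by (rule kernel_image_Def[OF X Z \<Delta> sub(2) B2_Def])

  have "({#?O#}, {#?E SS#}) \<in> SK_rel D a X"
  proof -
    \<comment> \<open>Both sides consist of the same concatenated lists \<open>z @ s @ s'\<close>, bracketed differently.\<close>
    have "w \<in> fiber_prod (fiber_prod Z p S (take a)) (drop a \<circ> drop n) S' (take b) \<longleftrightarrow>
        w \<in> fiber_prod Z p SS (\<lambda>w. take a (r w))" for w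
    proof
      assume "w \<in> fiber_prod (fiber_prod Z p S (take a)) (drop a \<circ> drop n) S' (take b)"
      then obtain z s s' where w: "w = z @ (s @ s')" "z \<in> Z" "s \<in> S" "s' \<in> S'" "p z = take a s"
        "drop a s = take b s'"
        by (auto simp: len elim!: fiber_prodE)
      then have "s @ s' \<in> SS" unfolding SS by (intro fiber_prodI)
      with w show "w \<in> fiber_prod Z p SS (\<lambda>w. take a (r w))"
        by (auto intro!: fiber_prodI simp: rX lenS)
    next
      assume "w \<in> fiber_prod Z p SS (\<lambda>w. take a (r w))"
      then obtain z v where v: "w = z @ v" "z \<in> Z" "v \<in> SS" "p z = take a (r v)" by (rule fiber_prodE)
      obtain s s' where s: "v = s @ s'" "s \<in> S" "s' \<in> S'" "drop a s = take b s'"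
        using v(3) unfolding SS by (rule fiber_prodE)
      have "w = (z @ s) @ s'" using v s by simp
      also have "\<dots> \<in> fiber_prod (fiber_prod Z p S (take a)) (drop a \<circ> drop n) S' (take b)"
        using v s rX(2)[OF v(3)] by (intro fiber_prodI) (auto simp: len lenS)
      finally show "w \<in> fiber_prod (fiber_prod Z p S (take a)) (drop a \<circ> drop n) S' (take b)" .
    qed
    then have eq: "?O = (n + ?K, fiber_prod Z p SS (\<lambda>w. take a (r w)), drop b \<circ> drop (n + (a + b)))"
      by (auto simp: add.assoc)
    have "isomorphic D (n + ?K, fiber_prod Z p SS (\<lambda>w. take a (r w)), drop b \<circ> drop (n + (a + b)))
      (n + ?K, fiber_prod Z p SS (\<lambda>w. take a (r w)), \<lambda>x. drop a (r (drop n x)))"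
      by (rule isomorphic_cong[OF R2(2)[unfolded eq]])
        (auto simp: rX len add.commute add.left_commute elim!: fiber_prodE)
    then show ?thesis unfolding eq kernel_image_def
      by (rule SK_rel.iso[OF R2(2)[unfolded eq] E_Def[unfolded kernel_image_def]])
  qed
  moreover have "({#?E SS#}, {#?E B1, ?E B2#}) \<in> SK_rel D a X"
    unfolding kernel_image_def
    by (rule SK_rel_disjoint[OF E_Def[unfolded kernel_image_def]
          Def_D[OF E_B1[unfolded kernel_image_def]] Def_D[OF E_B2[unfolded kernel_image_def]]])
      (auto simp: B1 B2 mem_fiber_prod[of Z n] len)
  moreover have "({#?E B1, ?E B2#}, {#?H k1 W1 ?X1#} + {#?H k1 W1 ?\<Delta>, ?H k2 W2 ?\<Delta>#}) \<in> SK_rel D a X"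
  proof -
    \<comment> \<open>The hypotheses on \<open>B\<^sub>1\<close> and \<open>B\<^sub>2\<close>, read as relations between multisets, are transported from
      \<open>X\<^sub>1\<close> and \<open>\<Delta>\<close> to \<open>X\<close> along the two kernel spans.\<close>
    have "SK_class D (a + a) ?X1 (?K, B1, r) = SK_rel D (a + a) ?X1 `` {{#?V k1 W1 ?X1#}}"
      using star view_over_class[OF c X1 Z1[unfolded Z1_eq]] by (simp add: Z1_eq SK_class_def)
    then have s1: "({#(?K, B1, r)#}, {#?V k1 W1 ?X1#}) \<in> SK_rel D (a + a) ?X1"
      by (rule SK_class_eqD[OF _ B1_Def])
    have "SK_class D (a + a) ?\<Delta> (?K, B2, r) = SK_rel D (a + a) ?\<Delta> `` {{#?V k1 W1 ?\<Delta>#} + {#?V k2 W2 ?\<Delta>#}}"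
      unfolding star_star
      unfolding Z1_eq Z2_eq view_over_class[OF c \<Delta> Z1[unfolded Z1_eq]]
        view_over_class[OF c \<Delta> Z2[unfolded Z2_eq]]
      unfolding SK_class_def
      by (rule SK_add_class) (use view_Def[OF W1 \<Delta>] view_Def[OF W2 \<Delta>] in \<open>auto simp: free_SK_def\<close>)
    then have s2: "({#(?K, B2, r)#}, {#?V k1 W1 ?\<Delta>#} + {#?V k2 W2 ?\<Delta>#}) \<in> SK_rel D (a + a) ?\<Delta>"
      by (rule SK_class_eqD[OF _ B2_Def])
    have "({#?E B1#}, {#?T ?X1 (?K, B1, r)#}) \<in> SK_rel D a X"
      by (rule SK_rel.sym[OF kernel_span_SK[OF X Z X1 sub(3) B1_Def]])
    moreover have "({#?T ?X1 (?K, B1, r)#}, {#?T ?X1 (?V k1 W1 ?X1)#}) \<in> SK_rel D a X"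
      using respects_SKD[OF respects_kernel_span[OF X Z X1 sub(3)] s1] by simp
    moreover have "({#?T ?X1 (?V k1 W1 ?X1)#}, {#?H k1 W1 ?X1#}) \<in> SK_rel D a X"
      by (rule kernel_span_view_SK[OF X Z X1 sub(3) W1])
    ultimately have 1: "({#?E B1#}, {#?H k1 W1 ?X1#}) \<in> SK_rel D a X"
      by (blast intro: SK_rel.trans)
    have "({#?E B2#}, {#?T ?\<Delta> (?K, B2, r)#}) \<in> SK_rel D a X"
      by (rule SK_rel.sym[OF kernel_span_SK[OF X Z \<Delta> sub(2) B2_Def]])
    moreover have "({#?T ?\<Delta> (?K, B2, r)#}, {#?T ?\<Delta> (?V k1 W1 ?\<Delta>)#} + {#?T ?\<Delta> (?V k2 W2 ?\<Delta>)#}) \<in> SK_rel D a X"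
      using respects_SKD[OF respects_kernel_span[OF X Z \<Delta> sub(2)] s2] by simp
    moreover have "({#?T ?\<Delta> (?V k1 W1 ?\<Delta>)#} + {#?T ?\<Delta> (?V k2 W2 ?\<Delta>)#}, {#?H k1 W1 ?\<Delta>#} + {#?H k2 W2 ?\<Delta>#}) \<in> SK_rel D a X"
      by (rule SK_rel_add[OF kernel_span_view_SK[OF X Z \<Delta> sub(2) W1] kernel_span_view_SK[OF X Z \<Delta> sub(2) W2]])
    ultimately have 2: "({#?E B2#}, {#?H k1 W1 ?\<Delta>#} + {#?H k2 W2 ?\<Delta>#}) \<in> SK_rel D a X"
      by (blast intro: SK_rel.trans)
    show ?thesis using SK_rel_add[OF 1 2] by (simp add: add_mset_commute)
  qed
  moreover have "({#?H k1 W1 ?X1#} + {#?H k1 W1 ?\<Delta>, ?H k2 W2 ?\<Delta>#},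
      {#?H k1 W1 ?XX#} + {#?H k2 W2 ?\<Delta>#}) \<in> SK_rel D a X"
  proof -
    note H_Def = cprod_Def[OF W1 kernel_apex_maps(2)[OF X Z]]
    have "({#?H k1 W1 ?XX#}, {#?H k1 W1 ?X1, ?H k1 W1 ?\<Delta>#}) \<in> SK_rel D a X"
    proof (rule SK_rel_disjoint[OF H_Def[OF XX sub(1)] Def_D[OF H_Def[OF X1 sub(3)]]
          Def_D[OF H_Def[OF \<Delta> sub(2)]]])
      have *: "x \<in> cprod W1 (kernel_apex a Z p U) \<longleftrightarrow> take k1 x \<in> W1 \<and> take n (drop k1 x) \<in> Z \<and>
          drop n (drop k1 x) \<in> U \<and> p (take n (drop k1 x)) = take a (drop n (drop k1 x))" for x U
        unfolding kernel_apex_def using mem_cprod[OF D_length[OF W1]] mem_fiber_prod[of Z n] len(3)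
        by blast
      show "cprod W1 (kernel_apex a Z p ?XX) =
          cprod W1 (kernel_apex a Z p ?X1) \<union> cprod W1 (kernel_apex a Z p ?\<Delta>)"
        using sub(2) by (auto simp only: * Un_iff Diff_iff)
      show "cprod W1 (kernel_apex a Z p ?X1) \<inter> cprod W1 (kernel_apex a Z p ?\<Delta>) = {}"
        by (auto simp only: * Int_iff Diff_iff empty_iff)
    qed
    moreover have "({#?H k2 W2 ?\<Delta>#}, {#?H k2 W2 ?\<Delta>#}) \<in> SK_rel D a X"
      using cprod_Def[OF W2 kernel_apex_maps(2)[OF X Z \<Delta> sub(2)]]
      by (intro SK_rel.refl) (simp add: free_SK_def)
    ultimately have "({#?H k1 W1 ?XX#} + {#?H k2 W2 ?\<Delta>#}, {#?H k1 W1 ?X1, ?H k1 W1 ?\<Delta>#} + {#?H k2 W2 ?\<Delta>#})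
        \<in> SK_rel D a X"
      by (rule SK_rel_add)
    then show ?thesis by (intro SK_rel.sym[where v = "{#?H k1 W1 ?X1#} + _"]) (simp add: add_mset_commute)
  qed
  moreover have "({#?H k1 W1 ?XX#} + {#?H k2 W2 ?\<Delta>#},
      {#fiber_obj ?view1 ?viewZ#} + {#fiber_obj ?view2 (n, Z, p)#}) \<in> SK_rel D a X"
    by (rule SK_rel_add[OF square_view_SK[OF X Z W1] diagonal_view_SK[OF X Z W2]])
  ultimately have main: "({#?O#}, {#fiber_obj ?view1 ?viewZ#} + {#fiber_obj ?view2 (n, Z, p)#}) \<in> SK_rel D a X"
    by (blast intro: SK_rel.trans)

  have Zc: "(n, Z, \<lambda>_. c) \<in> Def D l {c}"
    unfolding mem_Def by (rule definable_map_const[OF Def_D[OF Z] c])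
  note views = view_Def[OF W1 X] view_Def[OF W2 X] view_Def[OF Def_D[OF Z] X]
  have "(view_over D a X (SK_class D l {c} Z2) \<otimes>\<^bsub>SK0 D a X\<^esub> SK_class D a X (n, Z, p))
      \<oplus>\<^bsub>SK0 D a X\<^esub>
    (view_over D a X (SK_class D l {c} Z1) \<otimes>\<^bsub>SK0 D a X\<^esub>
      view_over D a X (SK_class D l {c} (n, Z, \<lambda>_. c))) =
    SK_rel D a X `` {mult_free {#?view2#} {#(n, Z, p)#} + mult_free {#?view1#} {#?viewZ#}}"
    unfolding Z1_eq Z2_eq view_over_class[OF c X Z1[unfolded Z1_eq]]
      view_over_class[OF c X Z2[unfolded Z2_eq]] view_over_class[OF c X Zc]
    unfolding SK_class_def
    by (subst SK_mult_class SK_add_class;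
        use views Z fiber_obj_Def'[OF views(1,3)] fiber_obj_Def'[OF views(2) Z]
        in \<open>simp add: free_SK_def mult_free_def del: fiber_obj.simps\<close>)+
  also have "\<dots> = SK_rel D a X `` {{#fiber_obj ?view1 ?viewZ#} + {#fiber_obj ?view2 (n, Z, p)#}}"
    by (simp add: mult_free_def add_mset_commute)
  also have "\<dots> = SK_rel D a X `` {{#?O#}}"
    by (rule SK_rel_class_eq[OF SK_rel.sym[OF main]])
  finally show ?thesis unfolding R1(1) R2(1) by (simp add: SK_class_def)
qed

end

theorem mainTheorem6:
  fixes L :: "('f, 'r) language" and T :: "('f, 'r) fo_formula set"
    and M :: "('f, 'r, 'm) fo_structure" and A :: "'m set"
    and c1 c2 :: 'f and pt :: "'m list set"
    and D :: "nat \<Rightarrow> 'm list set \<Rightarrow> bool"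
    and a b n :: nat
    and X Y S S' SS X1 \<Delta> B1 B2 Z :: "'m list set"
    and r p :: "'m list \<Rightarrow> 'm list"
    and Z1 Z2 :: "nat \<times> 'm list set \<times> ('m list \<Rightarrow> 'm list)"
    and rhs :: "nat \<times> 'm list set \<times> ('m list \<Rightarrow> 'm list) \<Rightarrow> (nat \<times> 'm list set \<times> ('m list \<Rightarrow> 'm list)) multiset set"
  assumes "is_theory L T" and "is_model M T"
    and "is_constant L c1" and "is_constant L c2" and "const_val M c1 \<noteq> const_val M c2"
    and D: "D = definable L M A"
    and pt: "pt = {[const_val M c1]}"
    and "D a X" and "D b Y"
    and "D (a + b) S" and "S \<subseteq> cprod X Y"
    and "D (b + a) S'" and "S' \<subseteq> cprod Y X"
    and SS: "SS = fiber_prod S (drop a) S' (take b)"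
    and r: "r = (\<lambda>w. take a w @ drop (a + b + b) w)"
    and \<Delta>: "\<Delta> = diagonal X" and X1: "X1 = cprod X X - \<Delta>"
    and B1: "B1 = SS - r -` \<Delta>" and B2: "B2 = SS \<inter> r -` \<Delta>"
    and "Z1 \<in> Def D 1 pt"
    and star: "SK_class D (a + a) X1 (a + b + (b + a), B1, r)
      = view_over D (a + a) X1 (SK_class D 1 pt Z1)"
    and "Z2 \<in> Def D 1 pt"
    and star_star: "SK_class D (a + a) \<Delta> (a + b + (b + a), B2, r)
      = view_over D (a + a) \<Delta> (SK_class D 1 pt Z1)
          \<oplus>\<^bsub>SK0 D (a + a) \<Delta>\<^esub> view_over D (a + a) \<Delta> (SK_class D 1 pt Z2)"
    and "(n, Z, p) \<in> Def D a X"
    and rhs: "rhs = (\<lambda>W. (view_over D a X (SK_class D 1 pt W) \<otimes>\<^bsub>SK0 D a X\<^esub> SK_class D a X (n, Z, p))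
        \<oplus>\<^bsub>SK0 D a X\<^esub>
        (view_over D a X (SK_class D 1 pt Z1) \<otimes>\<^bsub>SK0 D a X\<^esub>
          view_over D a X (SK_class D 1 pt (n, Z, \<lambda>_. [const_val M c1]))))"
  shows "(radon D b a X S' \<circ> radon D a b Y S) (SK_class D a X (n, Z, p)) = rhs Z2
    \<and> (\<forall>Z2' \<in> Def D 1 pt.
          SK_class D (a + a) \<Delta> (a + b + (b + a), B2, r)
            = view_over D (a + a) \<Delta> (SK_class D 1 pt Z1)
                \<oplus>\<^bsub>SK0 D (a + a) \<Delta>\<^esub> view_over D (a + a) \<Delta> (SK_class D 1 pt Z2')
          \<longrightarrow> rhs Z2 = rhs Z2')"
proof -
  interpret definable_sets D unfolding D by (rule definable_sets_definable)
  have c: "D 1 {[const_val M c1]}" unfolding D by (rule definable_const) fact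
  have "(radon D b a X S' \<circ> radon D a b Y S) (SK_class D a X (n, Z, p)) = rhs W"
    if "W \<in> Def D 1 pt" "SK_class D (a + a) \<Delta> (a + b + (b + a), B2, r)
            = view_over D (a + a) \<Delta> (SK_class D 1 pt Z1)
                \<oplus>\<^bsub>SK0 D (a + a) \<Delta>\<^esub> view_over D (a + a) \<Delta> (SK_class D 1 pt W)" for W
    unfolding comp_apply rhs pt
    by (rule radon_inversion[OF \<open>D a X\<close> \<open>D b Y\<close> \<open>D (a + b) S\<close> \<open>S \<subseteq> cprod X Y\<close>
          \<open>D (b + a) S'\<close> \<open>S' \<subseteq> cprod Y X\<close> c SS r B1[unfolded \<Delta>] B2[unfolded \<Delta>]
          \<open>Z1 \<in> Def D 1 pt\<close>[unfolded pt] that(1)[unfolded pt] star[unfolded X1 \<Delta> pt]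
          that(2)[unfolded \<Delta> pt] \<open>(n, Z, p) \<in> Def D a X\<close>])
  then show ?thesis using \<open>Z2 \<in> Def D 1 pt\<close> star_star by metis
qed

end
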